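(* Let $A$ be a Marot ring. If $A$ is an SP-ring, then $A$ is an N-ring.
   Context: All rings are commutative with $1$. For a ring $A$, $\mathrm{Reg}(A)$ is the set of regular elements (non-zerodivisors) of $A$, and a regular ideal is an ideal containing a regular element. A Marot ring is a ring in which every regular ideal is generated by regular elements. An ideal $I$ is radical if $\sqrt{I}=I$ (the whole ring counts as a radical ideal). An SP-ring is a ring in which every regular ideal is a (finite) product of radical ideals. For a prime ideal $P$ of $A$, $A_{(P)}$ denotes the regular localization $A_T$, where $T=\mathrm{Reg}(A)\cap(A\setminus P)$; it is a subring of the total quotient ring $K=A_{\mathrm{Reg}(A)}$. A discrete rank one Manis valuation ring is a ring $V$ with total quotient ring $K$ for which there is a surjective map $v:K\to\mathbb{Z}\cup\{\infty\}$ with $v(1)=0$, $v(0)=\infty$, $v(xy)=v(x)+v(y)$, $v(x+y)\ge\min\{v(x),v(y)\}$ for all $x,y\in K$, and $V=\{x\in K: v(x)\ge 0\}$. An N-ring is a ring $A$ such that $A_{(M)}$ is a discrete rank one Manis valuation ring for each regular maximal ideal $M$ of $A$. *)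

theory Defs
  imports "HOL-Algebra.Subrings" "HOL-Algebra.Ideal_Product" "HOL-Library.Extended"
begin

section \<open>Regular elements and ideals\<close>

definition Reg :: "('a, 'b) ring_scheme \<Rightarrow> 'a set"
  where "Reg A = {a \<in> carrier A. \<forall>x \<in> carrier A. a \<otimes>\<^bsub>A\<^esub> x = \<zero>\<^bsub>A\<^esub> \<longrightarrow> x = \<zero>\<^bsub>A\<^esub>}"

definition regular_ideal :: "'a set \<Rightarrow> ('a, 'b) ring_scheme \<Rightarrow> bool"
  where "regular_ideal I A \<longleftrightarrow> ideal I A \<and> I \<inter> Reg A \<noteq> {}"

definition marot_ring :: "('a, 'b) ring_scheme \<Rightarrow> bool"
  where "marot_ring A \<longleftrightarrow>
    cring A \<and> (\<forall>I. regular_ideal I A \<longrightarrow> (\<exists>S \<subseteq> Reg A. I = genideal A S))"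

definition radical :: "('a, 'b) ring_scheme \<Rightarrow> 'a set \<Rightarrow> 'a set"
  where "radical A I = {x \<in> carrier A. \<exists>n::nat. 0 < n \<and> x [^]\<^bsub>A\<^esub> n \<in> I}"

definition radical_ideal :: "'a set \<Rightarrow> ('a, 'b) ring_scheme \<Rightarrow> bool"
  where "radical_ideal I A \<longleftrightarrow> ideal I A \<and> radical A I = I"

text \<open>The empty product of ideals is the whole ring, which is itself a radical ideal, so
  it makes no difference that the list of factors may be empty.\<close>

definition SP_ring :: "('a, 'b) ring_scheme \<Rightarrow> bool"
  where "SP_ring A \<longleftrightarrow> cring A \<and>
    (\<forall>I. regular_ideal I A \<longrightarrow>
      (\<exists>Js. (\<forall>J \<in> set Js. radical_ideal J A) \<and> I = foldr (ideal_prod A) Js (carrier A)))"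

section \<open>The total quotient ring and regular localizations\<close>

text \<open>\<open>fraction A a s\<close> is the fraction \<open>a / s\<close>: the class of the pair \<open>(a, s)\<close>. The usual extra
  factor \<open>u (a t - b s) = 0\<close> is not needed since all denominators are regular.\<close>

definition fraction :: "('a, 'b) ring_scheme \<Rightarrow> 'a \<Rightarrow> 'a \<Rightarrow> ('a \<times> 'a) set"
  where "fraction A a s = {(b, t) \<in> carrier A \<times> Reg A. a \<otimes>\<^bsub>A\<^esub> t = b \<otimes>\<^bsub>A\<^esub> s}"

text \<open>In \<open>monoid.mult\<close> and \<open>ring.add\<close> below, the fraction does not depend on the representatives
  (see \<open>total_quot_mult\<close> and \<open>total_quot_add\<close>), so each union is a union of equal sets.\<close>

definition total_quot :: "('a, 'b) ring_scheme \<Rightarrow> ('a \<times> 'a) set ring"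
  where "total_quot A =
    \<lparr> carrier = {fraction A a s | a s. a \<in> carrier A \<and> s \<in> Reg A},
      monoid.mult = (\<lambda>U V. \<Union>(a, s) \<in> U. \<Union>(b, t) \<in> V. fraction A (a \<otimes>\<^bsub>A\<^esub> b) (s \<otimes>\<^bsub>A\<^esub> t)),
      one = fraction A \<one>\<^bsub>A\<^esub> \<one>\<^bsub>A\<^esub>,
      ring.zero = fraction A \<zero>\<^bsub>A\<^esub> \<one>\<^bsub>A\<^esub>,
      ring.add = (\<lambda>U V. \<Union>(a, s) \<in> U. \<Union>(b, t) \<in> V.
               fraction A (a \<otimes>\<^bsub>A\<^esub> t \<oplus>\<^bsub>A\<^esub> b \<otimes>\<^bsub>A\<^esub> s) (s \<otimes>\<^bsub>A\<^esub> t)) \<rparr>"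

text \<open>\<open>A\<^sub>(\<^sub>P\<^sub>)\<close> as a subset of the total quotient ring.\<close>

definition regular_localization :: "('a, 'b) ring_scheme \<Rightarrow> 'a set \<Rightarrow> ('a \<times> 'a) set set"
  where "regular_localization A P =
    {fraction A a t | a t. a \<in> carrier A \<and> t \<in> Reg A \<inter> (carrier A - P)}"

section \<open>Discrete rank one Manis valuation rings and N-rings\<close>

text \<open>The subring \<open>V\<close> of \<open>K\<close> has \<open>K\<close> as its total quotient ring.\<close>

definition has_total_quotient_ring :: "'k set \<Rightarrow> ('k, 'm) ring_scheme \<Rightarrow> bool"
  where "has_total_quotient_ring V K \<longleftrightarrow>
    cring K \<and> subring V K \<and>
    Reg (K\<lparr>carrier := V\<rparr>) \<subseteq> Units K \<and>
    carrier K = {a \<otimes>\<^bsub>K\<^esub> inv\<^bsub>K\<^esub> s | a s. a \<in> V \<and> s \<in> Reg (K\<lparr>carrier := V\<rparr>)}"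

text \<open>The type \<open>int extended\<close> also contains \<open>-\<infinity>\<close>; the image condition says that \<open>v\<close> maps
  \<open>K\<close> onto the integers together with \<open>\<infinity>\<close>.\<close>

definition discrete_rank_one_Manis_valuation_ring :: "'k set \<Rightarrow> ('k, 'm) ring_scheme \<Rightarrow> bool"
  where "discrete_rank_one_Manis_valuation_ring V K \<longleftrightarrow>
    has_total_quotient_ring V K \<and>
    (\<exists>v :: 'k \<Rightarrow> int extended.
       v ` carrier K = range Fin \<union> {\<infinity>} \<and>
       v \<one>\<^bsub>K\<^esub> = 0 \<and> v \<zero>\<^bsub>K\<^esub> = \<infinity> \<and>
       (\<forall>x \<in> carrier K. \<forall>y \<in> carrier K.
          v (x \<otimes>\<^bsub>K\<^esub> y) = v x + v y \<and> v (x \<oplus>\<^bsub>K\<^esub> y) \<ge> min (v x) (v y)) \<and>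
       V = {x \<in> carrier K. v x \<ge> 0})"

definition N_ring :: "('a, 'b) ring_scheme \<Rightarrow> bool"
  where "N_ring A \<longleftrightarrow> cring A \<and>
    (\<forall>M. maximalideal M A \<and> regular_ideal M A \<longrightarrow>
      discrete_rank_one_Manis_valuation_ring (regular_localization A M) (total_quot A))"

section \<open>Well-definedness of the total quotient ring\<close>

lemma UN_pairs_const:
  assumes F: "(a, s) \<in> F" and G: "(b, t) \<in> G"
    and const: "\<And>a s b t. \<lbrakk>(a, s) \<in> F; (b, t) \<in> G\<rbrakk> \<Longrightarrow> f a s b t = C"
  shows "(\<Union>(a, s) \<in> F. \<Union>(b, t) \<in> G. f a s b t) = C"
proof (intro equalityI subsetI)
  fix x assume "x \<in> (\<Union>(a, s) \<in> F. \<Union>(b, t) \<in> G. f a s b t)"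
  then obtain a s b t where "(a, s) \<in> F" "(b, t) \<in> G" "x \<in> f a s b t" by blast
  then show "x \<in> C" using const by simp
next
  fix x assume "x \<in> C"
  then have "x \<in> f a s b t" using const[OF F G] by simp
  then show "x \<in> (\<Union>(a, s) \<in> F. \<Union>(b, t) \<in> G. f a s b t)" using F G by blast
qed

context cring
begin

lemma Reg_closed: "s \<in> Reg R \<Longrightarrow> s \<in> carrier R"
  by (simp add: Reg_def)

lemma Reg_one [simp]: "\<one> \<in> Reg R"
  by (simp add: Reg_def)

lemma RegD: "\<lbrakk>s \<in> Reg R; x \<in> carrier R; s \<otimes> x = \<zero>\<rbrakk> \<Longrightarrow> x = \<zero>"
  unfolding Reg_def by blast

lemma Reg_mult [simp]:
  assumes s: "s \<in> Reg R" and t: "t \<in> Reg R"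
  shows "s \<otimes> t \<in> Reg R"
  unfolding Reg_def
proof (intro CollectI conjI ballI impI)
  note closed = s[THEN Reg_closed] t[THEN Reg_closed]
  show "s \<otimes> t \<in> carrier R" using closed by simp
  fix x assume x: "x \<in> carrier R" and "s \<otimes> t \<otimes> x = \<zero>"
  then have "s \<otimes> (t \<otimes> x) = \<zero>" using closed by (simp add: m_assoc)
  then have "t \<otimes> x = \<zero>" using RegD[OF s] closed x by simp
  then show "x = \<zero>" by (rule RegD[OF t x])
qed

lemma Reg_cancel:
  assumes s: "s \<in> Reg R" and ab: "a \<in> carrier R" "b \<in> carrier R" and eq: "s \<otimes> a = s \<otimes> b"
  shows "a = b"
proof -
  have "s \<otimes> (a \<ominus> b) = \<zero>"
    using Reg_closed[OF s] ab eq by (simp add: minus_eq r_distr r_minus r_neg)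
  then have "a \<ominus> b = \<zero>" using RegD[OF s] ab by simp
  then show ?thesis using ab by simp
qed

context
  notes Reg_closed [simp]
begin

lemma fraction_self: "\<lbrakk>a \<in> carrier R; s \<in> Reg R\<rbrakk> \<Longrightarrow> (a, s) \<in> fraction R a s"
  by (simp add: fraction_def)

lemma fraction_eq_iff:
  assumes "a \<in> carrier R" "s \<in> Reg R" "b \<in> carrier R" "t \<in> Reg R"
  shows "fraction R a s = fraction R b t \<longleftrightarrow> a \<otimes> t = b \<otimes> s"
proof
  assume "fraction R a s = fraction R b t"
  then have "(b, t) \<in> fraction R a s" using fraction_self assms by simp
  then show "a \<otimes> t = b \<otimes> s" by (simp add: fraction_def)
next
  have sub: "fraction R a s \<subseteq> fraction R b t"
    if "a \<in> carrier R" "s \<in> Reg R" "b \<in> carrier R" "t \<in> Reg R" "a \<otimes> t = b \<otimes> s" for a s b t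
  proof clarify
    fix c u assume "(c, u) \<in> fraction R a s"
    then have c: "c \<in> carrier R" "u \<in> Reg R" "a \<otimes> u = c \<otimes> s" by (auto simp: fraction_def)
    have "s \<otimes> (b \<otimes> u) = (b \<otimes> s) \<otimes> u" using that c by (simp add: m_ac)
    also have "\<dots> = (a \<otimes> u) \<otimes> t" using that(1-4) c(1,2) by (simp add: that(5)[symmetric] m_ac)
    also have "\<dots> = s \<otimes> (c \<otimes> t)" using that(1-4) c(1,2) by (simp add: c(3) m_ac)
    finally have "b \<otimes> u = c \<otimes> t"
      by (rule Reg_cancel[OF that(2), rotated 2]) (use that(1-4) c(1,2) in simp_all)
    then show "(c, u) \<in> fraction R b t" using c by (simp add: fraction_def)
  qed
  assume "a \<otimes> t = b \<otimes> s"
  then show "fraction R a s = fraction R b t" using sub[of a s b t] sub[of b t a s] assms by auto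
qed

lemma mem_fraction_eq:
  assumes "a \<in> carrier R" "s \<in> Reg R" "(b, t) \<in> fraction R a s"
  shows "b \<in> carrier R" "t \<in> Reg R" "fraction R b t = fraction R a s" "a \<otimes> t = b \<otimes> s"
  using assms fraction_eq_iff[of b t a s] by (auto simp: fraction_def)

lemma total_quot_mult:
  assumes a: "a \<in> carrier R" "s \<in> Reg R" and b: "b \<in> carrier R" "t \<in> Reg R"
  shows "fraction R a s \<otimes>\<^bsub>total_quot R\<^esub> fraction R b t = fraction R (a \<otimes> b) (s \<otimes> t)"
proof -
  have "fraction R (a' \<otimes> b') (s' \<otimes> t') = fraction R (a \<otimes> b) (s \<otimes> t)"
    if "(a', s') \<in> fraction R a s" "(b', t') \<in> fraction R b t" for a' s' b' t'
  proof -
    note 1 = mem_fraction_eq[OF a that(1)] and 2 = mem_fraction_eq[OF b that(2)]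
    have "(a' \<otimes> b') \<otimes> (s \<otimes> t) = (a' \<otimes> s) \<otimes> (b' \<otimes> t)" using 1(1,2) 2(1,2) a b by (simp add: m_ac)
    also have "\<dots> = (a \<otimes> s') \<otimes> (b \<otimes> t')" using 1(4) 2(4) by simp
    also have "\<dots> = (a \<otimes> b) \<otimes> (s' \<otimes> t')" using 1(1,2) 2(1,2) a b by (simp add: m_ac)
    finally show ?thesis using 1 2 a b by (simp add: fraction_eq_iff)
  qed
  then show ?thesis
    unfolding total_quot_def monoid.simps ring.simps
    by (rule UN_pairs_const[OF fraction_self[OF a] fraction_self[OF b]])
qed

lemma total_quot_add:
  assumes a: "a \<in> carrier R" "s \<in> Reg R" and b: "b \<in> carrier R" "t \<in> Reg R"
  shows "fraction R a s \<oplus>\<^bsub>total_quot R\<^esub> fraction R b t = fraction R (a \<otimes> t \<oplus> b \<otimes> s) (s \<otimes> t)"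
proof -
  have "fraction R (a' \<otimes> t' \<oplus> b' \<otimes> s') (s' \<otimes> t') = fraction R (a \<otimes> t \<oplus> b \<otimes> s) (s \<otimes> t)"
    if "(a', s') \<in> fraction R a s" "(b', t') \<in> fraction R b t" for a' s' b' t'
  proof -
    note 1 = mem_fraction_eq[OF a that(1)] and 2 = mem_fraction_eq[OF b that(2)]
    have "(a' \<otimes> t' \<oplus> b' \<otimes> s') \<otimes> (s \<otimes> t) = (a' \<otimes> s) \<otimes> (t' \<otimes> t) \<oplus> (b' \<otimes> t) \<otimes> (s' \<otimes> s)"
      using 1(1,2) 2(1,2) a b by (simp add: m_ac l_distr r_distr)
    also have "\<dots> = (a \<otimes> s') \<otimes> (t' \<otimes> t) \<oplus> (b \<otimes> t') \<otimes> (s' \<otimes> s)" using 1(4) 2(4) by simp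
    also have "\<dots> = (a \<otimes> t \<oplus> b \<otimes> s) \<otimes> (s' \<otimes> t')"
      using 1(1,2) 2(1,2) a b by (simp add: m_ac l_distr r_distr)
    finally show ?thesis using 1 2 a b by (simp add: fraction_eq_iff)
  qed
  then show ?thesis
    unfolding total_quot_def monoid.simps ring.simps
    by (rule UN_pairs_const[OF fraction_self[OF a] fraction_self[OF b]])
qed

lemma total_quot_carrier:
  "carrier (total_quot R) = {fraction R a s | a s. a \<in> carrier R \<and> s \<in> Reg R}"
  by (simp add: total_quot_def)

lemma total_quot_one: "\<one>\<^bsub>total_quot R\<^esub> = fraction R \<one> \<one>"
  by (simp add: total_quot_def)

lemma total_quot_zero: "\<zero>\<^bsub>total_quot R\<^esub> = fraction R \<zero> \<one>"
  by (simp add: total_quot_def)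

lemma total_quot_add_same:
  assumes "a \<in> carrier R" "b \<in> carrier R" "s \<in> Reg R"
  shows "fraction R a s \<oplus>\<^bsub>total_quot R\<^esub> fraction R b s = fraction R (a \<oplus> b) s"
proof -
  have "(a \<otimes> s \<oplus> b \<otimes> s) \<otimes> s = (a \<oplus> b) \<otimes> (s \<otimes> s)"
    using assms by (simp add: l_distr m_assoc)
  then show ?thesis using assms by (simp add: total_quot_add fraction_eq_iff)
qed

lemma fraction_expand:
  "\<lbrakk>a \<in> carrier R; s \<in> Reg R; t \<in> Reg R\<rbrakk> \<Longrightarrow> fraction R a s = fraction R (a \<otimes> t) (s \<otimes> t)"
  by (simp add: fraction_eq_iff m_ac)

lemma total_quot_common_denominator:
  assumes "x \<in> carrier (total_quot R)" "y \<in> carrier (total_quot R)" "z \<in> carrier (total_quot R)"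
  obtains a b c s where "a \<in> carrier R" "b \<in> carrier R" "c \<in> carrier R" "s \<in> Reg R"
    "x = fraction R a s" "y = fraction R b s" "z = fraction R c s"
proof -
  obtain a s b t c u where *: "a \<in> carrier R" "b \<in> carrier R" "c \<in> carrier R"
    "s \<in> Reg R" "t \<in> Reg R" "u \<in> Reg R" "x = fraction R a s" "y = fraction R b t" "z = fraction R c u"
    using assms unfolding total_quot_carrier by blast
  have "x = fraction R (a \<otimes> (t \<otimes> u)) (s \<otimes> (t \<otimes> u))"
    using * fraction_expand[of a s "t \<otimes> u"] by simp
  moreover have "y = fraction R (b \<otimes> (s \<otimes> u)) (s \<otimes> (t \<otimes> u))"
    using * fraction_expand[of b t "s \<otimes> u"] by (simp add: m_lcomm[of s t u])
  moreover have "z = fraction R (c \<otimes> (s \<otimes> t)) (s \<otimes> (t \<otimes> u))"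
    using * fraction_expand[of c u "s \<otimes> t"] by (simp add: m_ac)
  ultimately show ?thesis using * by (intro that) auto
qed

lemma total_quot_cring: "cring (total_quot R)"
proof -
  let ?K = "total_quot R"
  have fraction_closed: "fraction R a s \<in> carrier ?K" if "a \<in> carrier R" "s \<in> Reg R" for a s
    using that by (auto simp: total_quot_carrier)
  have zero: "\<zero>\<^bsub>?K\<^esub> \<in> carrier ?K" and one: "\<one>\<^bsub>?K\<^esub> \<in> carrier ?K"
    by (simp_all add: total_quot_zero total_quot_one fraction_closed)
  have laws:
    "x \<oplus>\<^bsub>?K\<^esub> y \<in> carrier ?K" "x \<otimes>\<^bsub>?K\<^esub> y \<in> carrier ?K"
    "x \<oplus>\<^bsub>?K\<^esub> y = y \<oplus>\<^bsub>?K\<^esub> x" "x \<otimes>\<^bsub>?K\<^esub> y = y \<otimes>\<^bsub>?K\<^esub> x"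
    "(x \<oplus>\<^bsub>?K\<^esub> y) \<oplus>\<^bsub>?K\<^esub> z = x \<oplus>\<^bsub>?K\<^esub> (y \<oplus>\<^bsub>?K\<^esub> z)"
    "(x \<otimes>\<^bsub>?K\<^esub> y) \<otimes>\<^bsub>?K\<^esub> z = x \<otimes>\<^bsub>?K\<^esub> (y \<otimes>\<^bsub>?K\<^esub> z)"
    "(x \<oplus>\<^bsub>?K\<^esub> y) \<otimes>\<^bsub>?K\<^esub> z = x \<otimes>\<^bsub>?K\<^esub> z \<oplus>\<^bsub>?K\<^esub> y \<otimes>\<^bsub>?K\<^esub> z"
    "\<zero>\<^bsub>?K\<^esub> \<oplus>\<^bsub>?K\<^esub> x = x" "\<one>\<^bsub>?K\<^esub> \<otimes>\<^bsub>?K\<^esub> x = x"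
    "\<exists>w \<in> carrier ?K. w \<oplus>\<^bsub>?K\<^esub> x = \<zero>\<^bsub>?K\<^esub>"
    if xyz: "x \<in> carrier ?K" "y \<in> carrier ?K" "z \<in> carrier ?K" for x y z
  proof -
    obtain a b c s where *: "a \<in> carrier R" "b \<in> carrier R" "c \<in> carrier R" "s \<in> Reg R"
      and eq: "x = fraction R a s" "y = fraction R b s" "z = fraction R c s"
      by (rule total_quot_common_denominator[OF xyz])
    have zero_s: "\<zero>\<^bsub>?K\<^esub> = fraction R \<zero> s"
      using * by (simp add: total_quot_zero fraction_eq_iff)
    have neg: "fraction R (\<ominus> a) s \<oplus>\<^bsub>?K\<^esub> x = \<zero>\<^bsub>?K\<^esub>"
      using * by (simp add: eq zero_s total_quot_add_same l_neg)
    note simps = eq zero_s total_quot_one total_quot_add_same total_quot_mult fraction_closed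
    show "x \<oplus>\<^bsub>?K\<^esub> y \<in> carrier ?K" "x \<otimes>\<^bsub>?K\<^esub> y \<in> carrier ?K"
      using * by (simp_all add: simps)
    show "x \<oplus>\<^bsub>?K\<^esub> y = y \<oplus>\<^bsub>?K\<^esub> x" "x \<otimes>\<^bsub>?K\<^esub> y = y \<otimes>\<^bsub>?K\<^esub> x"
      using * by (simp_all add: simps a_comm m_comm[of a b])
    show "(x \<oplus>\<^bsub>?K\<^esub> y) \<oplus>\<^bsub>?K\<^esub> z = x \<oplus>\<^bsub>?K\<^esub> (y \<oplus>\<^bsub>?K\<^esub> z)"
      "(x \<otimes>\<^bsub>?K\<^esub> y) \<otimes>\<^bsub>?K\<^esub> z = x \<otimes>\<^bsub>?K\<^esub> (y \<otimes>\<^bsub>?K\<^esub> z)"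
      using * by (simp_all add: simps a_assoc m_assoc)
    show "(x \<oplus>\<^bsub>?K\<^esub> y) \<otimes>\<^bsub>?K\<^esub> z = x \<otimes>\<^bsub>?K\<^esub> z \<oplus>\<^bsub>?K\<^esub> y \<otimes>\<^bsub>?K\<^esub> z"
      using * by (simp add: simps l_distr)
    show "\<zero>\<^bsub>?K\<^esub> \<oplus>\<^bsub>?K\<^esub> x = x" "\<one>\<^bsub>?K\<^esub> \<otimes>\<^bsub>?K\<^esub> x = x"
      using * by (simp_all add: simps)
    show "\<exists>w \<in> carrier ?K. w \<oplus>\<^bsub>?K\<^esub> x = \<zero>\<^bsub>?K\<^esub>"
      using * neg fraction_closed[of "\<ominus> a" s] by auto
  qed
  note laws' = laws(1-4)[OF _ _ zero] laws(5-7) laws(8-10)[OF _ zero zero]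
  have ab: "abelian_group ?K"
    by (rule abelian_groupI; (rule zero | (rule laws'; assumption)))
  have cm: "comm_monoid ?K"
    by (rule comm_monoidI; (rule one | (rule laws'; assumption)))
  show ?thesis
    by (rule cringI[OF ab cm]; (rule laws'; assumption))
qed

end

end

end

theory Submission
  imports Defs
begin

text \<open>Let \<open>M\<close> be a regular prime ideal of a Marot SP-ring. The point is to find a uniformizer of
  \<open>M\<close>: a regular \<open>x \<in> M\<close> that generates \<open>M\<close> locally at \<open>M\<close>. Localizations are avoided: that \<open>a\<close>
  lies in \<open>I\<close> locally at \<open>Q\<close> means that \<open>t a \<in> I\<close> for some \<open>t \<notin> Q\<close>, i.e. that \<open>a\<close> is in the
  saturation of \<open>I\<close>. The radical factors of a principal regular ideal are invertible, and the Marot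
  property makes an invertible ideal locally generated by one regular element
  (\<open>invertible_ideal_locally_principal\<close>).

  Dichotomy (\<open>prime_idempotent_or_uniformizer\<close>): a regular prime \<open>Q\<close> has a uniformizer or
  \<open>Q = Q\<^sup>2\<close>. Indeed let \<open>x \<in> Q\<close> be regular and \<open>J \<subseteq> Q\<close> a radical factor of \<open>(x)\<close>. If \<open>J\<close> is not
  locally equal to \<open>Q\<close>, pick \<open>z \<in> Q\<close> not locally in \<open>J\<close> and factor \<open>J + (z\<^sup>2)\<close> into radical ideals, all
  of which contain \<open>z\<close>. With only one factor inside \<open>Q\<close>, the product would locally contain \<open>z\<close>,
  and then so would \<open>J\<close>; with two, \<open>x \<in> J \<subseteq> Q\<^sup>2\<close>.

  Existence (\<open>exists_uniformizer\<close>): let \<open>P \<subseteq> M\<close> be a prime minimal over such a \<open>J \<subseteq> M\<close>. If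
  \<open>P = M\<close>, then \<open>M\<close> is locally \<open>J\<close>, hence locally principal. Otherwise take \<open>z \<in> M - P\<close> and a prime
  \<open>Q \<subseteq> M\<close> minimal over \<open>P + (z)\<close>. A uniformizer \<open>y\<close> of \<open>Q\<close> would give \<open>P = y P \<subseteq> (y\<^sup>2)\<close> locally at
  \<open>Q\<close>, but a radical invertible ideal such as \<open>J\<close> is never locally inside \<open>(y\<^sup>2)\<close>
  (\<open>radical_invertible_not_in_square\<close>). If instead \<open>Q = Q\<^sup>2\<close>, each radical factor of \<open>P + (z\<^sup>2)\<close>
  contains \<open>Q\<close> locally, hence so does their product; thus \<open>z\<close> is locally in \<open>P + (z\<^sup>2)\<close>, and
  therefore in \<open>P\<close>, a contradiction.

  Finally, a regular element \<open>s\<close> has finite order with respect to a uniformizer \<open>x\<close> of \<open>M\<close>, because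
  \<open>(s)\<close> is a product of radical invertible ideals and each contributes at most 1
  (\<open>regular_element_finite_order\<close>). So every element of the total quotient ring is multiplied into
  the regular localization \<open>V\<close> by a power of \<open>x\<close>, and \<open>x V\<close> is a prime ideal of \<open>V\<close>; the filtration by
  the sets \<open>x\<^sup>e V\<close>, where \<open>e\<close> is an integer, then defines the valuation
  (\<open>discrete_valuation_of_prime_element\<close>).\<close>

section \<open>Saturation at a prime ideal\<close>

context cring
begin

text \<open>The contraction to the ring of the extension of \<open>I\<close> to the localization at \<open>Q\<close>. The multiplier
  ranges over all elements outside \<open>Q\<close>, regular or not; see \<open>marot_regular_multiplier\<close>.\<close>

definition saturation :: "'a set \<Rightarrow> 'a set \<Rightarrow> 'a set"
  where "saturation Q I = {a \<in> carrier R. \<exists>t \<in> carrier R - Q. t \<otimes> a \<in> I}"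

lemma saturationI:
  "\<lbrakk>t \<in> carrier R; t \<notin> Q; a \<in> carrier R; t \<otimes> a \<in> I\<rbrakk> \<Longrightarrow> a \<in> saturation Q I"
  unfolding saturation_def by blast

lemma saturationE:
  assumes "a \<in> saturation Q I"
  obtains t where "t \<in> carrier R" "t \<notin> Q" "a \<in> carrier R" "t \<otimes> a \<in> I"
  using assms unfolding saturation_def by blast

lemma primeideal_mult_notin:
  assumes "primeideal Q R" "s \<in> carrier R" "s \<notin> Q" "t \<in> carrier R" "t \<notin> Q"
  shows "s \<otimes> t \<notin> Q"
  using primeideal.I_prime[OF assms(1,2,4)] assms by blast

lemma primeideal_one_notin: "primeideal Q R \<Longrightarrow> \<one> \<notin> Q"
  using primeideal.I_notcarr primeideal.axioms(1) ideal.one_imp_carrier by blast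

lemma cring_idealI:
  assumes sub: "I \<subseteq> carrier R" and zero: "\<zero> \<in> I"
    and add: "\<And>a b. \<lbrakk>a \<in> I; b \<in> I\<rbrakk> \<Longrightarrow> a \<oplus> b \<in> I"
    and mult: "\<And>r a. \<lbrakk>r \<in> carrier R; a \<in> I\<rbrakk> \<Longrightarrow> r \<otimes> a \<in> I"
  shows "ideal I R"
proof (rule idealI[OF ring_axioms])
  show "subgroup I (add_monoid R)"
  proof (rule add.subgroupI[OF sub])
    show "I \<noteq> {}" using zero by blast
    show "\<ominus> a \<in> I" if "a \<in> I" for a
      using mult[of "\<ominus> \<one>" a] that sub by (simp add: subset_iff l_minus)
  qed (use add in auto)
  show "x \<otimes> a \<in> I" "a \<otimes> x \<in> I" if "a \<in> I" "x \<in> carrier R" for a x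
    using mult[of x a] that sub by (auto simp: subset_iff m_comm[of a x])
qed

lemma ideal_closure:
  assumes "ideal I R"
  shows "\<zero> \<in> I" "a \<in> I \<Longrightarrow> a \<in> carrier R" "\<lbrakk>a \<in> I; b \<in> I\<rbrakk> \<Longrightarrow> a \<oplus> b \<in> I"
    "\<lbrakk>a \<in> I; r \<in> carrier R\<rbrakk> \<Longrightarrow> r \<otimes> a \<in> I" "\<lbrakk>a \<in> I; r \<in> carrier R\<rbrakk> \<Longrightarrow> a \<otimes> r \<in> I"
proof -
  interpret ideal I R by fact
  show "\<zero> \<in> I" "a \<in> I \<Longrightarrow> a \<in> carrier R" "\<lbrakk>a \<in> I; b \<in> I\<rbrakk> \<Longrightarrow> a \<oplus> b \<in> I"
    "\<lbrakk>a \<in> I; r \<in> carrier R\<rbrakk> \<Longrightarrow> r \<otimes> a \<in> I" "\<lbrakk>a \<in> I; r \<in> carrier R\<rbrakk> \<Longrightarrow> a \<otimes> r \<in> I"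
    by (auto simp: I_l_closed I_r_closed)
qed

lemma colon_ideal:
  assumes I: "ideal I R" and b: "b \<in> carrier R"
  shows "ideal {a \<in> carrier R. a \<otimes> b \<in> I} R"
  by (rule cring_idealI) (use I b in \<open>auto simp: ideal_closure l_distr m_assoc\<close>)

lemma saturation_ideal:
  assumes Q: "primeideal Q R" and I: "ideal I R"
  shows "ideal (saturation Q I) R"
proof (rule cring_idealI)
  show "saturation Q I \<subseteq> carrier R" by (auto simp: saturation_def)
  show "\<zero> \<in> saturation Q I"
    by (rule saturationI[of \<one>]) (use Q I in \<open>auto simp: primeideal_one_notin ideal_closure\<close>)
  show "a \<oplus> b \<in> saturation Q I" if ab: "a \<in> saturation Q I" "b \<in> saturation Q I" for a b
  proof -
    obtain s t where s: "s \<in> carrier R" "s \<notin> Q" "a \<in> carrier R" "s \<otimes> a \<in> I"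
      and t: "t \<in> carrier R" "t \<notin> Q" "b \<in> carrier R" "t \<otimes> b \<in> I"
      using ab by (blast elim: saturationE)
    have "(s \<otimes> t) \<otimes> (a \<oplus> b) = t \<otimes> (s \<otimes> a) \<oplus> s \<otimes> (t \<otimes> b)"
      using s t by (simp add: r_distr m_ac)
    then have "(s \<otimes> t) \<otimes> (a \<oplus> b) \<in> I" using s t I by (simp add: ideal_closure)
    then show ?thesis
      by (rule saturationI[rotated 3]) (use s t Q in \<open>simp_all add: primeideal_mult_notin\<close>)
  qed
  show "r \<otimes> a \<in> saturation Q I" if r: "r \<in> carrier R" and a: "a \<in> saturation Q I" for r a
  proof -
    obtain s where s: "s \<in> carrier R" "s \<notin> Q" "a \<in> carrier R" "s \<otimes> a \<in> I"
      using a by (elim saturationE)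
    then have "s \<otimes> (r \<otimes> a) \<in> I"
      using r I ideal_closure(4)[OF I, of "s \<otimes> a" r] by (simp add: m_lcomm)
    then show ?thesis by (rule saturationI[rotated 3]) (use s r in simp_all)
  qed
qed

lemma ideal_subset_saturation:
  assumes "primeideal Q R" "ideal I R"
  shows "I \<subseteq> saturation Q I"
proof
  fix a assume "a \<in> I"
  then show "a \<in> saturation Q I"
    using assms by (intro saturationI[of \<one>]) (auto simp: primeideal_one_notin ideal_closure)
qed

lemma saturation_mono: "I \<subseteq> J \<Longrightarrow> saturation Q I \<subseteq> saturation Q J"
  by (auto simp: saturation_def)

lemma saturation_cancel:
  assumes Q: "primeideal Q R" and t: "t \<in> carrier R" "t \<notin> Q"
    and a: "a \<in> carrier R" "t \<otimes> a \<in> saturation Q I"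
  shows "a \<in> saturation Q I"
proof -
  obtain s where s: "s \<in> carrier R" "s \<notin> Q" "s \<otimes> (t \<otimes> a) \<in> I"
    using a(2) by (elim saturationE)
  show ?thesis
    by (rule saturationI[of "s \<otimes> t"])
      (use s t a Q in \<open>simp_all add: primeideal_mult_notin m_assoc\<close>)
qed

lemma ideal_prod_subset:
  assumes "ideal L R" "\<And>i j. \<lbrakk>i \<in> I; j \<in> J\<rbrakk> \<Longrightarrow> i \<otimes> j \<in> L"
  shows "ideal_prod R I J \<subseteq> L"
proof
  fix a assume "a \<in> ideal_prod R I J"
  then show "a \<in> L" by induction (use assms in \<open>auto simp: ideal_closure\<close>)
qed

lemma saturation_mult:
  assumes Q: "primeideal Q R" and I: "ideal I R" and J: "ideal J R"
    and a: "a \<in> saturation Q I" and b: "b \<in> saturation Q J"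
  shows "a \<otimes> b \<in> saturation Q (ideal_prod R I J)"
proof -
  obtain s t where s: "s \<in> carrier R" "s \<notin> Q" "a \<in> carrier R" "s \<otimes> a \<in> I"
    and t: "t \<in> carrier R" "t \<notin> Q" "b \<in> carrier R" "t \<otimes> b \<in> J"
    using a b by (blast elim: saturationE)
  have "(s \<otimes> a) \<otimes> (t \<otimes> b) \<in> ideal_prod R I J" using s t by (intro ideal_prod.prod)
  moreover have "(s \<otimes> a) \<otimes> (t \<otimes> b) = (s \<otimes> t) \<otimes> (a \<otimes> b)" using s t by (simp add: m_ac)
  ultimately show ?thesis
    by (intro saturationI[of "s \<otimes> t"]) (use s t Q in \<open>simp_all add: primeideal_mult_notin\<close>)
qed

section \<open>Minimal primes of radical ideals\<close>

lemma radical_idealD: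
  assumes "radical_ideal I R" "x \<in> carrier R" "x [^] (n::nat) \<in> I" "0 < n"
  shows "x \<in> I"
  using assms unfolding radical_ideal_def radical_def by blast

lemma radical_ideal_ideal: "radical_ideal I R \<Longrightarrow> ideal I R"
  by (simp add: radical_ideal_def)

lemma radical_ideal_square:
  assumes "radical_ideal I R" "x \<in> carrier R" "x \<otimes> x \<in> I"
  shows "x \<in> I"
  using radical_idealD[of I x 2] assms by (simp add: numeral_2_eq_2)

text \<open>A prime between \<open>I\<close> and \<open>M\<close> that is minimal over \<open>I\<close>, in the form in which minimality is used:
  locally at \<open>P\<close>, the ideal \<open>P\<close> is contained in \<open>I\<close>. Zorn's lemma is applied to the multiplicative sets that
  contain the complement of \<open>M\<close> and avoid \<open>I\<close>; the complement of a maximal one is \<open>P\<close>. Since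
  \<open>I\<close> is radical, maximality says that \<open>q \<in> P\<close> iff \<open>s q \<in> I\<close> for some \<open>s\<close> in the
  multiplicative set, which makes \<open>P\<close> visibly an ideal.\<close>

lemma exists_minimal_prime:
  assumes M: "primeideal M R" and I: "radical_ideal I R" and IM: "I \<subseteq> M"
  obtains P where "primeideal P R" "I \<subseteq> P" "P \<subseteq> M" "P \<subseteq> saturation P I"
proof -
  note idI = radical_ideal_ideal[OF I]
  define F where "F = {S. carrier R - M \<subseteq> S \<and> S \<subseteq> carrier R \<and> S \<inter> I = {} \<and>
    (\<forall>s\<in>S. \<forall>t\<in>S. s \<otimes> t \<in> S)}"
  have "carrier R - M \<in> F"
    using M IM primeideal_mult_notin[OF M] by (auto simp: F_def)
  moreover have "\<Union>C \<in> F" if C: "C \<noteq> {}" "subset.chain F C" for C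
  proof -
    have CF: "C \<subseteq> F" and lin: "\<And>X Y. \<lbrakk>X \<in> C; Y \<in> C\<rbrakk> \<Longrightarrow> X \<subseteq> Y \<or> Y \<subseteq> X"
      using C(2) by (auto simp: subset_chain_def)
    have "s \<otimes> t \<in> \<Union>C" if "X \<in> C" "Y \<in> C" "s \<in> X" "t \<in> Y" for X Y s t
      using lin[OF that(1,2)] CF that unfolding F_def by blast
    then show ?thesis using C(1) CF unfolding F_def by blast
  qed
  ultimately obtain S where SF: "S \<in> F" and max: "\<And>X. \<lbrakk>X \<in> F; S \<subseteq> X\<rbrakk> \<Longrightarrow> X = S"
    using subset_Zorn_nonempty[of F] by blast
  have S: "carrier R - M \<subseteq> S" "S \<subseteq> carrier R" "S \<inter> I = {}"
    "\<And>s t. \<lbrakk>s \<in> S; t \<in> S\<rbrakk> \<Longrightarrow> s \<otimes> t \<in> S"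
    using SF by (auto simp: F_def)
  have oneS: "\<one> \<in> S" using S(1) primeideal_one_notin[OF M] by auto
  have powS: "s [^] (n::nat) \<in> S" if "s \<in> S" for s n
    by (induction n) (use oneS S(4) that in auto)
  have key: "\<exists>s\<in>S. s \<otimes> q \<in> I" if q: "q \<in> carrier R" "q \<notin> S" for q
  proof -
    \<comment> \<open>the multiplicative set generated by \<open>S\<close> and \<open>q\<close>, which must meet \<open>I\<close> by maximality\<close>
    define S' where "S' = {s \<otimes> q [^] (n::nat) | s n. s \<in> S}"
    have "S \<subseteq> S'"
    proof
      fix s assume "s \<in> S"
      then have "s = s \<otimes> q [^] (0::nat)" using S(2) by auto
      then show "s \<in> S'" using \<open>s \<in> S\<close> unfolding S'_def by blast
    qed
    have "q = \<one> \<otimes> q [^] (1::nat)" using q by simp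
    then have "q \<in> S'" using oneS unfolding S'_def by blast
    have mult: "a \<otimes> b \<in> S'" if ab: "a \<in> S'" "b \<in> S'" for a b
    proof -
      obtain s m t n where "a = s \<otimes> q [^] (m::nat)" "b = t \<otimes> q [^] (n::nat)" "s \<in> S" "t \<in> S"
        using ab unfolding S'_def by blast
      moreover from this have "a \<otimes> b = (s \<otimes> t) \<otimes> q [^] (m + n)"
        using S(2) q by (simp add: subset_iff m_ac flip: nat_pow_mult)
      ultimately show ?thesis using S(4) unfolding S'_def by blast
    qed
    have "S' \<subseteq> carrier R" using S(2) q by (auto simp: S'_def)
    have "S' \<notin> F" using max[of S'] \<open>S \<subseteq> S'\<close> \<open>q \<in> S'\<close> q by blast
    then have "S' \<inter> I \<noteq> {}"
      using mult S(1) \<open>S \<subseteq> S'\<close> \<open>S' \<subseteq> carrier R\<close> unfolding F_def by blast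
    then obtain s n where s: "s \<in> S" "s \<otimes> q [^] (n::nat) \<in> I" unfolding S'_def by blast
    have sc: "s \<in> carrier R" using s S(2) by blast
    have "n \<noteq> 0" using s S(3) sc by (cases n) auto
    then obtain k where n: "n = Suc k" using not0_implies_Suc by blast
    have "(s \<otimes> q) [^] n = s [^] k \<otimes> (s \<otimes> q [^] n)"
      using sc q by (simp add: n nat_pow_distrib m_ac)
    then have "(s \<otimes> q) [^] n \<in> I" using s(2) sc idI by (simp add: ideal_closure)
    then have "s \<otimes> q \<in> I" using radical_idealD[OF I, of "s \<otimes> q" n] n sc q by simp
    then show ?thesis using s(1) by blast
  qed
  define P where "P = carrier R - S"
  have P_iff: "q \<in> P \<longleftrightarrow> q \<in> carrier R \<and> (\<exists>s\<in>S. s \<otimes> q \<in> I)" for q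
    using key S(3,4) unfolding P_def by blast
  have idP: "ideal P R"
  proof (rule cring_idealI)
    show "P \<subseteq> carrier R" by (auto simp: P_def)
    show "\<zero> \<in> P" using oneS idI by (auto simp: P_iff ideal_closure intro!: bexI[of _ \<one>])
    show "a \<oplus> b \<in> P" if P: "a \<in> P" "b \<in> P" for a b
    proof -
      obtain s t where st: "s \<in> S" "s \<otimes> a \<in> I" "t \<in> S" "t \<otimes> b \<in> I"
        and ab: "a \<in> carrier R" "b \<in> carrier R"
        using P unfolding P_iff by blast
      have stc: "s \<in> carrier R" "t \<in> carrier R" using st S(2) by auto
      have "(s \<otimes> t) \<otimes> (a \<oplus> b) = t \<otimes> (s \<otimes> a) \<oplus> s \<otimes> (t \<otimes> b)"
        using stc ab by (simp add: r_distr m_ac)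
      then have "(s \<otimes> t) \<otimes> (a \<oplus> b) \<in> I" using st stc idI by (simp add: ideal_closure)
      then show ?thesis using S(4)[OF st(1,3)] ab unfolding P_iff by blast
    qed
    show "r \<otimes> a \<in> P" if r: "r \<in> carrier R" and "a \<in> P" for r a
    proof -
      obtain s where s: "s \<in> S" "s \<otimes> a \<in> I" and a: "a \<in> carrier R"
        using \<open>a \<in> P\<close> unfolding P_iff by blast
      have "s \<in> carrier R" using s S(2) by auto
      then have "s \<otimes> (r \<otimes> a) = r \<otimes> (s \<otimes> a)" using a r by (simp add: m_ac)
      then have "s \<otimes> (r \<otimes> a) \<in> I" using s r idI by (simp add: ideal_closure)
      then show ?thesis using s a r unfolding P_iff by blast
    qed
  qed
  have "primeideal P R"
    by (rule primeidealI[OF idP cring_axioms]) (use oneS S(2,4) in \<open>auto simp: P_def\<close>)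
  moreover have "I \<subseteq> P" using S(3) idI by (auto simp: P_def ideal_closure)
  moreover have "P \<subseteq> M" using S(1) by (auto simp: P_def)
  moreover have "P \<subseteq> saturation P I"
    using S(2) P_iff unfolding saturation_def P_def by blast
  ultimately show ?thesis by (rule that)
qed

section \<open>Products of lists of ideals\<close>

abbreviation ideals_prod :: "'a set list \<Rightarrow> 'a set"
  where "ideals_prod Js \<equiv> foldr (ideal_prod R) Js (carrier R)"

lemma ideals_prod_ideal:
  "(\<And>J. J \<in> set Js \<Longrightarrow> ideal J R) \<Longrightarrow> ideal (ideals_prod Js) R"
  by (induction Js) (simp_all add: oneideal ideal_prod_is_ideal)

lemma ideals_prod_factor:
  assumes "\<And>J. J \<in> set Js \<Longrightarrow> ideal J R" "J \<in> set Js"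
  shows "\<exists>J'. ideal J' R \<and> ideals_prod Js = ideal_prod R J J'"
  using assms
proof (induction Js)
  case (Cons K Ks)
  show ?case
  proof (cases "J = K")
    case True
    then show ?thesis using Cons.prems by (auto intro!: exI[of _ "ideals_prod Ks"] ideals_prod_ideal)
  next
    case False
    then obtain J' where J': "ideal J' R" "ideals_prod Ks = ideal_prod R J J'"
      using Cons by auto
    have "ideal K R" "ideal J R" using Cons.prems by auto
    then have "ideals_prod (K # Ks) = ideal_prod R J (ideal_prod R K J')"
      using J' by (simp add: ideal_prod_commute[of K J] flip: ideal_prod_assoc)
    then show ?thesis using ideal_prod_is_ideal[OF \<open>ideal K R\<close> J'(1)] by blast
  qed
qed simp

lemma ideals_prod_subset:
  assumes "\<And>J. J \<in> set Js \<Longrightarrow> ideal J R" "J \<in> set Js"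
  shows "ideals_prod Js \<subseteq> J"
  using ideals_prod_factor[OF assms] ideal_prod_inter assms by fastforce

lemma pow_mem_ideals_prod:
  assumes "a \<in> carrier R" "\<And>J. J \<in> set Js \<Longrightarrow> a \<in> J"
  shows "a [^] length Js \<in> ideals_prod Js"
  using assms(2)
proof (induction Js)
  case (Cons J Js)
  then have "a \<otimes> a [^] length Js \<in> ideal_prod R J (ideals_prod Js)"
    by (intro ideal_prod.prod) auto
  then show ?case using assms(1) by (simp add: m_comm)
qed simp

lemma ideals_prod_subset_prime:
  assumes "primeideal Q R" "ideals_prod Js \<subseteq> Q" "\<And>J. J \<in> set Js \<Longrightarrow> ideal J R"
  shows "\<exists>J\<in>set Js. J \<subseteq> Q"
  using assms(2,3)
proof (induction Js)
  case Nil
  then show ?case using primeideal_one_notin[OF assms(1)] by auto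
next
  case (Cons J Js)
  show ?case
  proof (rule ccontr)
    assume neg: "\<not> ?thesis"
    then obtain a where a: "a \<in> J" "a \<notin> Q" by auto
    have "\<not> ideals_prod Js \<subseteq> Q" using neg Cons by auto
    then obtain b where b: "b \<in> ideals_prod Js" "b \<notin> Q" by blast
    have "a \<in> carrier R" "b \<in> carrier R"
      using a b ideals_prod_ideal[of Js] Cons.prems(2) ideal.Icarr by fastforce+
    then have "a \<otimes> b \<notin> Q" using primeideal_mult_notin[OF assms(1)] a b by blast
    moreover have "a \<otimes> b \<in> ideal_prod R J (ideals_prod Js)"
      using a b by (intro ideal_prod.prod)
    ultimately show False using Cons.prems(1) by auto
  qed
qed

text \<open>Counts the factors inside \<open>Q\<close>: none, at least two, or exactly one. In the last case the product
  agrees with that factor locally at \<open>Q\<close>, since each of the others contains an element outside \<open>Q\<close>.\<close>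

lemma ideals_prod_in_prime_cases:
  assumes Q: "primeideal Q R" and "\<And>J. J \<in> set Js \<Longrightarrow> ideal J R"
  shows "\<not> ideals_prod Js \<subseteq> Q \<or> ideals_prod Js \<subseteq> ideal_prod R Q Q \<or>
    (\<exists>J\<in>set Js. J \<subseteq> Q \<and> J \<subseteq> saturation Q (ideals_prod Js))"
  using assms(2)
proof (induction Js)
  case Nil
  then show ?case using primeideal_one_notin[OF Q] by auto
next
  case (Cons J Js)
  have idQ: "ideal Q R" using Q by (rule primeideal.axioms)
  have J: "ideal J R" and L: "ideal (ideals_prod Js) R"
    using Cons.prems by (auto intro: ideals_prod_ideal)
  have JL: "ideal (ideal_prod R J (ideals_prod Js)) R" by (rule ideal_prod_is_ideal[OF J L])
  consider "J \<subseteq> Q" "ideals_prod Js \<subseteq> Q" | "J \<subseteq> Q" "\<not> ideals_prod Js \<subseteq> Q"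
    | s where "s \<in> J" "s \<notin> Q" by blast
  then show ?case
  proof cases
    case 1
    have "ideal_prod R J (ideals_prod Js) \<subseteq> ideal_prod R Q Q"
      by (rule ideal_prod_subset[OF ideal_prod_is_ideal[OF idQ idQ]])
        (use 1 in \<open>auto intro: ideal_prod.prod\<close>)
    then show ?thesis by simp
  next
    case 2
    then obtain t where t: "t \<in> ideals_prod Js" "t \<notin> Q" by blast
    have "J \<subseteq> saturation Q (ideal_prod R J (ideals_prod Js))"
    proof
      fix a assume a: "a \<in> J"
      have c: "t \<in> carrier R" "a \<in> carrier R" using t a J L by (auto simp: ideal_closure)
      have "a \<otimes> t \<in> ideal_prod R J (ideals_prod Js)" using a t by (intro ideal_prod.prod)
      then show "a \<in> saturation Q (ideal_prod R J (ideals_prod Js))"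
        using c t by (intro saturationI[of t]) (simp_all add: m_comm)
    qed
    then show ?thesis using 2 by auto
  next
    case 3
    have s: "s \<in> carrier R" using 3 J by (simp add: ideal_closure)
    have sat: "a \<in> saturation Q (ideal_prod R J (ideals_prod Js))" if "a \<in> ideals_prod Js" for a
      by (rule saturationI[of s]) (use that s 3 L in \<open>auto simp: ideal_closure intro: ideal_prod.prod\<close>)
    from Cons.IH Cons.prems consider "\<not> ideals_prod Js \<subseteq> Q"
      | "ideals_prod Js \<subseteq> ideal_prod R Q Q"
      | K where "K \<in> set Js" "K \<subseteq> Q" "K \<subseteq> saturation Q (ideals_prod Js)" by auto
    then show ?thesis
    proof cases
      case 1
      then obtain t where t: "t \<in> ideals_prod Js" "t \<notin> Q" by blast
      have "s \<otimes> t \<in> ideal_prod R J (ideals_prod Js)" using 3 t by (intro ideal_prod.prod)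
      moreover have "s \<otimes> t \<notin> Q" using primeideal_mult_notin[OF Q s] 3 t L by (auto simp: ideal_closure)
      ultimately show ?thesis by auto
    next
      case 2
      then show ?thesis using ideal_prod_inter[OF J L] by auto
    next
      case (3 K)
      have "K \<subseteq> saturation Q (ideal_prod R J (ideals_prod Js))"
      proof
        fix a assume "a \<in> K"
        then obtain t where t: "t \<in> carrier R" "t \<notin> Q" "a \<in> carrier R" "t \<otimes> a \<in> ideals_prod Js"
          using 3 by (blast elim: saturationE)
        show "a \<in> saturation Q (ideal_prod R J (ideals_prod Js))"
          by (rule saturation_cancel[OF Q t(1-3) sat[OF t(4)]])
      qed
      then show ?thesis using 3 by auto
    qed
  qed
qed

section \<open>Marot rings and invertible ideals\<close>

lemma PIdl_iff: "a \<in> PIdl x \<longleftrightarrow> (\<exists>c \<in> carrier R. a = c \<otimes> x)"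
  by (auto simp: cgenideal_def)

lemma PIdl_regular:
  assumes "x \<in> Reg R"
  shows "regular_ideal (PIdl x) R"
  using assms cgenideal_ideal cgenideal_self Reg_closed unfolding regular_ideal_def by blast

lemma regular_ideal_mono:
  "\<lbrakk>regular_ideal I R; I \<subseteq> J; ideal J R\<rbrakk> \<Longrightarrow> regular_ideal J R"
  unfolding regular_ideal_def by blast

lemma Reg_factor:
  assumes "a \<in> carrier R" "b \<in> carrier R" "a \<otimes> b \<in> Reg R"
  shows "a \<in> Reg R"
  unfolding Reg_def
proof (intro CollectI conjI ballI impI)
  fix x assume x: "x \<in> carrier R" "a \<otimes> x = \<zero>"
  have "(a \<otimes> b) \<otimes> x = b \<otimes> (a \<otimes> x)" using assms x(1) by (simp add: m_ac)
  then show "x = \<zero>" using RegD[OF assms(3) x(1)] assms x by simp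
qed fact

lemma Reg_pow: "x \<in> Reg R \<Longrightarrow> x [^] (n::nat) \<in> Reg R"
  by (induction n) simp_all

text \<open>Generation by regular elements turns into an avoidance principle: in a Marot ring, non-containment
  of a regular ideal in any ideal is witnessed by a regular element.\<close>

lemma marot_regular_element:
  assumes "marot_ring R" "regular_ideal I R" "ideal L R" "\<not> I \<subseteq> L"
  obtains r where "r \<in> I" "r \<in> Reg R" "r \<notin> L"
proof -
  obtain S where S: "S \<subseteq> Reg R" "I = genideal R S"
    using assms unfolding marot_ring_def by blast
  have "S \<subseteq> carrier R" using S Reg_closed by blast
  then have "S \<subseteq> I" "\<not> S \<subseteq> L"
    using S(2) assms(4) genideal_self genideal_minimal[OF assms(3), of S] by auto
  then show ?thesis using S that by blast
qed

text \<open>The multipliers \<open>t\<close> with \<open>t a \<in> I\<close> form an ideal that contains \<open>I\<close>, hence a regular one. So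
  the localization at \<open>Q\<close> and the regular localization have the same effect on regular ideals.\<close>

lemma marot_regular_multiplier:
  assumes marot: "marot_ring R" and Q: "primeideal Q R" and I: "regular_ideal I R"
    and a: "a \<in> saturation Q I"
  obtains t where "t \<in> Reg R" "t \<notin> Q" "t \<otimes> a \<in> I"
proof -
  have idI: "ideal I R" using I by (simp add: regular_ideal_def)
  obtain s where s: "s \<in> carrier R" "s \<notin> Q" "a \<in> carrier R" "s \<otimes> a \<in> I"
    using a by (elim saturationE)
  let ?C = "{t \<in> carrier R. t \<otimes> a \<in> I}"
  have "ideal ?C R" by (rule colon_ideal[OF idI s(3)])
  moreover have "I \<subseteq> ?C" using idI s(3) by (auto simp: ideal_closure)
  ultimately have "regular_ideal ?C R" using regular_ideal_mono[OF I] by blast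
  moreover have "\<not> ?C \<subseteq> Q" using s by blast
  ultimately show ?thesis
    using marot_regular_element[OF marot _ primeideal.axioms(1)[OF Q]] that by blast
qed

definition invertible_ideal :: "'a set \<Rightarrow> bool"
  where "invertible_ideal J \<longleftrightarrow>
    ideal J R \<and> (\<exists>J' x. ideal J' R \<and> x \<in> Reg R \<and> ideal_prod R J J' = PIdl x)"

text \<open>Let \<open>J J' = (x)\<close>. As \<open>x \<notin> x Q\<close>, some product \<open>a b\<close> with \<open>a \<in> J\<close>, \<open>b \<in> J'\<close> lies outside \<open>x Q\<close>, and the Marot
  property lets both factors be replaced in turn by regular elements \<open>j\<close> and \<open>k\<close>. Then
  \<open>j k = u x\<close> with \<open>u \<notin> Q\<close>, and \<open>u J \<subseteq> (j)\<close>.\<close>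

lemma invertible_ideal_locally_principal:
  assumes marot: "marot_ring R" and Q: "primeideal Q R" and J: "invertible_ideal J"
  obtains j where "j \<in> J" "j \<in> Reg R" "J \<subseteq> saturation Q (PIdl j)"
proof -
  obtain J' x where idJ: "ideal J R" and idJ': "ideal J' R" and x: "x \<in> Reg R"
    and JJ': "ideal_prod R J J' = PIdl x"
    using J unfolding invertible_ideal_def by blast
  note xc = Reg_closed[OF x]
  have idQ: "ideal Q R" using Q by (rule primeideal.axioms)
  have xJ: "x \<in> J" "x \<in> J'"
    using ideal_prod_inter[OF idJ idJ'] cgenideal_self[OF xc] unfolding JJ' by auto
  have reg: "regular_ideal J R" "regular_ideal J' R"
    using idJ idJ' xJ x unfolding regular_ideal_def by auto
  let ?L = "ideal_prod R (PIdl x) Q"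
  have idL: "ideal ?L R" by (rule ideal_prod_is_ideal[OF cgenideal_ideal[OF xc] idQ])
  have L: "\<exists>q\<in>Q. a = x \<otimes> q" if "a \<in> ?L" for a
    using that
  proof induction
    case (prod i q)
    then obtain c where "c \<in> carrier R" "i = c \<otimes> x" by (auto simp: PIdl_iff)
    then show ?case
      using prod idQ xc by (intro bexI[of _ "c \<otimes> q"]) (auto simp: ideal_closure m_ac)
  next
    case (sum a b)
    then obtain p q where "p \<in> Q" "a = x \<otimes> p" "q \<in> Q" "b = x \<otimes> q" by blast
    then show ?case
      using idQ xc by (intro bexI[of _ "p \<oplus> q"]) (auto simp: ideal_closure r_distr)
  qed
  have "x \<notin> ?L"
  proof
    assume "x \<in> ?L"
    then obtain q where q: "q \<in> Q" "x = x \<otimes> q" using L by blast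
    have "\<one> = q" by (rule Reg_cancel[OF x]) (use q idQ xc in \<open>auto simp: ideal_closure\<close>)
    then show False using q primeideal_one_notin[OF Q] by simp
  qed
  then have "\<not> ideal_prod R J J' \<subseteq> ?L" using JJ' cgenideal_self[OF xc] by blast
  then obtain a b where ab: "a \<in> J" "b \<in> J'" "a \<otimes> b \<notin> ?L"
    using ideal_prod_subset[OF idL] by blast
  have abc: "a \<in> carrier R" "b \<in> carrier R" using ab idJ idJ' by (auto simp: ideal_closure)
  have "\<not> J \<subseteq> {y \<in> carrier R. y \<otimes> b \<in> ?L}" using ab by blast
  then obtain j where j: "j \<in> J" "j \<in> Reg R" "j \<otimes> b \<notin> ?L"
    using marot_regular_element[OF marot reg(1) colon_ideal[OF idL abc(2)]] Reg_closed by blast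
  note jc = Reg_closed[OF j(2)]
  have "\<not> J' \<subseteq> {y \<in> carrier R. y \<otimes> j \<in> ?L}" using ab j abc jc by (auto simp: m_comm)
  then obtain k where k: "k \<in> J'" "k \<in> Reg R" "k \<otimes> j \<notin> ?L"
    using marot_regular_element[OF marot reg(2) colon_ideal[OF idL jc]] Reg_closed by blast
  note kc = Reg_closed[OF k(2)]
  have "j \<otimes> k \<in> PIdl x" using j k unfolding JJ'[symmetric] by (intro ideal_prod.prod)
  then obtain u where u: "u \<in> carrier R" "j \<otimes> k = u \<otimes> x" by (auto simp: PIdl_iff)
  have "u \<notin> Q"
  proof
    assume "u \<in> Q"
    then have "x \<otimes> u \<in> ?L" using cgenideal_self[OF xc] by (intro ideal_prod.prod)
    then show False using u k(3) xc jc kc by (simp add: m_comm)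
  qed
  have "J \<subseteq> saturation Q (PIdl j)"
  proof
    fix a assume a: "a \<in> J"
    then have ac: "a \<in> carrier R" using idJ by (simp add: ideal_closure)
    have "a \<otimes> k \<in> PIdl x" using a k unfolding JJ'[symmetric] by (intro ideal_prod.prod)
    then obtain c where c: "c \<in> carrier R" "a \<otimes> k = c \<otimes> x" by (auto simp: PIdl_iff)
    have "x \<otimes> (u \<otimes> a) = (u \<otimes> x) \<otimes> a" using xc u(1) ac by (simp add: m_ac)
    also have "\<dots> = (a \<otimes> k) \<otimes> j" using jc kc ac by (simp add: m_ac flip: u(2))
    also have "\<dots> = x \<otimes> (c \<otimes> j)" using xc jc c(1) by (simp add: m_ac c(2))
    finally have "u \<otimes> a = c \<otimes> j"
      by (rule Reg_cancel[OF x, rotated 2]) (use u c ac jc in simp_all)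
    then show "a \<in> saturation Q (PIdl j)"
      using u \<open>u \<notin> Q\<close> ac c by (intro saturationI[of u]) (auto simp: PIdl_iff)
  qed
  then show ?thesis using j that by blast
qed

section \<open>Uniformizers\<close>

definition uniformizer :: "'a set \<Rightarrow> 'a \<Rightarrow> bool"
  where "uniformizer Q x \<longleftrightarrow> x \<in> Q \<and> x \<in> Reg R \<and> Q \<subseteq> saturation Q (PIdl x)"

lemma SP_ring_factorization:
  assumes "SP_ring R" "regular_ideal I R"
  obtains Js where "\<And>J. J \<in> set Js \<Longrightarrow> radical_ideal J R" "I = ideals_prod Js"
  using assms unfolding SP_ring_def by blast

lemma SP_ring_invertible_factorization:
  assumes SP: "SP_ring R" and x: "x \<in> Reg R"
  obtains Js where "\<And>J. J \<in> set Js \<Longrightarrow> radical_ideal J R \<and> invertible_ideal J"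
    "PIdl x = ideals_prod Js"
proof -
  obtain Js where Js: "\<And>J. J \<in> set Js \<Longrightarrow> radical_ideal J R" "PIdl x = ideals_prod Js"
    using SP_ring_factorization[OF SP PIdl_regular[OF x]] by blast
  have "invertible_ideal J" if "J \<in> set Js" for J
    using ideals_prod_factor[of Js J] Js that x radical_ideal_ideal
    unfolding invertible_ideal_def by metis
  then show ?thesis using Js that by blast
qed

lemma SP_ring_radical_invertible_factor:
  assumes SP: "SP_ring R" and Q: "primeideal Q R" and x: "x \<in> Reg R" "x \<in> Q"
  obtains J where "radical_ideal J R" "invertible_ideal J" "x \<in> J" "J \<subseteq> Q"
proof -
  obtain Js where Js: "\<And>J. J \<in> set Js \<Longrightarrow> radical_ideal J R \<and> invertible_ideal J"
    "PIdl x = ideals_prod Js"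
    using SP_ring_invertible_factorization[OF SP x(1)] by blast
  have ids: "\<And>J. J \<in> set Js \<Longrightarrow> ideal J R" using Js(1) radical_ideal_ideal by blast
  have "ideals_prod Js \<subseteq> Q"
    using cgenideal_minimal[OF primeideal.axioms(1)[OF Q] x(2)] Js(2) by simp
  then obtain J where J: "J \<in> set Js" "J \<subseteq> Q"
    using ideals_prod_subset_prime[OF Q _ ids] by blast
  moreover have "x \<in> J"
    using ideals_prod_subset[OF ids J(1)] cgenideal_self[OF Reg_closed[OF x(1)]] Js(2) by auto
  ultimately show ?thesis using Js(1) that by blast
qed

abbreviation adjoin :: "'a set \<Rightarrow> 'a \<Rightarrow> 'a set"
  where "adjoin I z \<equiv> set_add R I (PIdl z)"

lemma mem_adjoin_iff: "a \<in> adjoin I z \<longleftrightarrow> (\<exists>p\<in>I. \<exists>c\<in>carrier R. a = p \<oplus> c \<otimes> z)"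
  by (auto simp: set_add_def' cgenideal_def)

lemma adjoin_ideal: "\<lbrakk>ideal I R; z \<in> carrier R\<rbrakk> \<Longrightarrow> ideal (adjoin I z) R"
  by (intro add_ideals cgenideal_ideal)

lemma subset_adjoin:
  assumes "ideal I R" "z \<in> carrier R"
  shows "I \<subseteq> adjoin I z"
proof
  fix a assume "a \<in> I"
  moreover from this have "a = a \<oplus> \<zero> \<otimes> z" using assms by (simp add: ideal_closure)
  ultimately show "a \<in> adjoin I z" unfolding mem_adjoin_iff by blast
qed

lemma self_in_adjoin:
  assumes "ideal I R" "z \<in> carrier R"
  shows "z \<in> adjoin I z"
proof -
  have "z = \<zero> \<oplus> \<one> \<otimes> z" using assms by simp
  then show ?thesis using assms ideal_closure(1) unfolding mem_adjoin_iff by blast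
qed

lemma adjoin_subset:
  assumes "ideal L R" "I \<subseteq> L" "z \<in> L"
  shows "adjoin I z \<subseteq> L"
  using assms by (auto simp: mem_adjoin_iff ideal_closure subset_iff)

text \<open>From \<open>t z = p + c z\<^sup>2\<close> with \<open>t \<notin> Q\<close> follows \<open>(t - c z) z \<in> I\<close>, and \<open>t - c z \<notin> Q\<close> because \<open>z \<in> Q\<close>.
  This is Nakayama's lemma for the ideal generated by \<open>z\<close> modulo \<open>I\<close>.\<close>

lemma saturation_add_square:
  assumes Q: "primeideal Q R" and I: "ideal I R" and z: "z \<in> Q"
    and sat: "z \<in> saturation Q (adjoin I (z \<otimes> z))"
  shows "z \<in> saturation Q I"
proof -
  have idQ: "ideal Q R" using Q by (rule primeideal.axioms)
  have zc: "z \<in> carrier R" using z idQ by (simp add: ideal_closure)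
  obtain t p c where t: "t \<in> carrier R" "t \<notin> Q" and p: "p \<in> I" and c: "c \<in> carrier R"
    and eq: "t \<otimes> z = p \<oplus> c \<otimes> (z \<otimes> z)"
    using sat by (auto elim!: saturationE simp: mem_adjoin_iff)
  have pc: "p \<in> carrier R" using p I by (simp add: ideal_closure)
  have "(t \<ominus> c \<otimes> z) \<otimes> z = t \<otimes> z \<ominus> c \<otimes> (z \<otimes> z)"
    using t c zc by (simp add: a_minus_def l_distr l_minus m_assoc)
  also have "\<dots> = p" unfolding eq using pc c zc by (simp add: a_minus_def a_assoc r_neg)
  finally have "(t \<ominus> c \<otimes> z) \<otimes> z \<in> I" using p by simp
  moreover have "t \<ominus> c \<otimes> z \<notin> Q"
  proof
    assume "t \<ominus> c \<otimes> z \<in> Q"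
    then have "(t \<ominus> c \<otimes> z) \<oplus> c \<otimes> z \<in> Q" using idQ z c by (simp add: ideal_closure)
    moreover have "(t \<ominus> c \<otimes> z) \<oplus> c \<otimes> z = t" using t c zc by (simp add: a_minus_def a_assoc l_neg)
    ultimately show False using t by simp
  qed
  ultimately show ?thesis using t c zc by (intro saturationI[of "t \<ominus> c \<otimes> z"]) simp_all
qed

text \<open>The core of the dichotomy. For a radical factor \<open>J \<subseteq> Q\<close> of \<open>(x)\<close>, a local generator \<open>j\<close> of \<open>J\<close> is not a
  uniformizer of \<open>Q\<close>, so some \<open>z \<in> Q\<close> is not locally in \<open>J\<close>. In the factorization of \<open>J + (z\<^sup>2)\<close>
  every radical factor contains \<open>z\<close>, so the product cannot be locally equal to a single factor,
  and at least two factors lie inside \<open>Q\<close>.\<close>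

lemma regular_mem_square_or_uniformizer:
  assumes marot: "marot_ring R" and SP: "SP_ring R" and Q: "primeideal Q R"
    and x: "x \<in> Reg R" "x \<in> Q" and no: "\<And>y. \<not> uniformizer Q y"
  shows "x \<in> ideal_prod R Q Q"
proof -
  have idQ: "ideal Q R" using Q by (rule primeideal.axioms)
  obtain J where J: "radical_ideal J R" "invertible_ideal J" "x \<in> J" "J \<subseteq> Q"
    using SP_ring_radical_invertible_factor[OF SP Q x] by blast
  note idJ = radical_ideal_ideal[OF J(1)]
  obtain j where j: "j \<in> J" "j \<in> Reg R" "J \<subseteq> saturation Q (PIdl j)"
    using invertible_ideal_locally_principal[OF marot Q J(2)] by blast
  note jc = Reg_closed[OF j(2)]
  have "\<not> Q \<subseteq> saturation Q (PIdl j)" using no j J(4) unfolding uniformizer_def by blast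
  then obtain z where z: "z \<in> Q" "z \<notin> saturation Q (PIdl j)" by blast
  have zc: "z \<in> carrier R" using z idQ by (simp add: ideal_closure)
  have zJ: "z \<notin> saturation Q J"
  proof
    assume "z \<in> saturation Q J"
    then obtain t where t: "t \<in> carrier R" "t \<notin> Q" "t \<otimes> z \<in> J" by (elim saturationE)
    then have "t \<otimes> z \<in> saturation Q (PIdl j)" using j(3) by blast
    then show False using saturation_cancel[OF Q t(1,2) zc] z(2) by blast
  qed
  let ?I = "adjoin J (z \<otimes> z)"
  have idI: "ideal ?I R" using idJ zc by (simp add: adjoin_ideal)
  have JI: "J \<subseteq> ?I" using subset_adjoin[OF idJ] zc by simp
  have zzI: "z \<otimes> z \<in> ?I" using self_in_adjoin[OF idJ] zc by simp
  have IQ: "?I \<subseteq> Q" using J(4) z zc idQ by (intro adjoin_subset) (auto simp: ideal_closure)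
  have "regular_ideal ?I R" using idI JI J(3) x(1) unfolding regular_ideal_def by blast
  then obtain Ks where Ks: "\<And>K. K \<in> set Ks \<Longrightarrow> radical_ideal K R" "?I = ideals_prod Ks"
    using SP_ring_factorization[OF SP] by blast
  have ids: "\<And>K. K \<in> set Ks \<Longrightarrow> ideal K R" using Ks(1) radical_ideal_ideal by blast
  have "\<not> (K \<subseteq> saturation Q ?I)" if K: "K \<in> set Ks" for K
  proof
    assume "K \<subseteq> saturation Q ?I"
    moreover have "z \<in> K"
      using ideals_prod_subset[OF ids K] zzI Ks radical_ideal_square[OF Ks(1)[OF K] zc] by auto
    ultimately show False using saturation_add_square[OF Q idJ z(1)] zJ by blast
  qed
  then have "?I \<subseteq> ideal_prod R Q Q"
    using ideals_prod_in_prime_cases[OF Q ids, of Ks] IQ Ks(2) by metis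
  then show ?thesis using J(3) JI by blast
qed

lemma prime_idempotent_or_uniformizer:
  assumes "marot_ring R" "SP_ring R" "primeideal Q R" "regular_ideal Q R"
    "\<And>y. \<not> uniformizer Q y"
  shows "Q \<subseteq> ideal_prod R Q Q"
proof (rule ccontr)
  have "ideal (ideal_prod R Q Q) R"
    using assms(3) by (intro ideal_prod_is_ideal primeideal.axioms(1))
  moreover assume "\<not> Q \<subseteq> ideal_prod R Q Q"
  ultimately obtain r where "r \<in> Q" "r \<in> Reg R" "r \<notin> ideal_prod R Q Q"
    using marot_regular_element[OF assms(1,4)] by blast
  then show False using regular_mem_square_or_uniformizer[OF assms(1-3) _ _ assms(5)] by blast
qed

text \<open>Suppose that a local generator \<open>j\<close> of \<open>J\<close> satisfies \<open>t j = c x\<^sup>2\<close> with \<open>t \<notin> Q\<close>. Then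
  \<open>(x c)\<^sup>2 = c t j\<close> is in \<open>J\<close>, so \<open>x c \<in> J\<close> as \<open>J\<close> is radical; locally \<open>x c\<close> is a multiple of \<open>j\<close>, so \<open>x\<^sup>2 c\<close>
  is a multiple of \<open>x j\<close>. Cancelling \<open>j\<close> puts an element outside \<open>Q\<close> into \<open>(x) \<subseteq> Q\<close>.\<close>

lemma radical_invertible_not_in_square:
  assumes marot: "marot_ring R" and Q: "primeideal Q R" and x: "uniformizer Q x"
    and J: "radical_ideal J R" "invertible_ideal J"
  shows "\<not> J \<subseteq> saturation Q (PIdl (x \<otimes> x))"
proof
  assume sub: "J \<subseteq> saturation Q (PIdl (x \<otimes> x))"
  note idJ = radical_ideal_ideal[OF J(1)]
  have idQ: "ideal Q R" using Q by (rule primeideal.axioms)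
  have xQ: "x \<in> Q" and xc: "x \<in> carrier R" using x Reg_closed by (auto simp: uniformizer_def)
  obtain j where j: "j \<in> J" "j \<in> Reg R" "J \<subseteq> saturation Q (PIdl j)"
    using invertible_ideal_locally_principal[OF marot Q J(2)] by blast
  note jc = Reg_closed[OF j(2)]
  obtain t c where t: "t \<in> carrier R" "t \<notin> Q" and c: "c \<in> carrier R" and tj: "t \<otimes> j = c \<otimes> (x \<otimes> x)"
    using saturationE[OF subsetD[OF sub j(1)]] unfolding PIdl_iff by metis
  have "(x \<otimes> c) \<otimes> (x \<otimes> c) = c \<otimes> (t \<otimes> j)" using xc c by (simp add: tj m_ac)
  then have "(x \<otimes> c) \<otimes> (x \<otimes> c) \<in> J" using idJ j(1) t c by (simp add: ideal_closure)
  then have xcJ: "x \<otimes> c \<in> J"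
    by (rule radical_ideal_square[OF J(1), rotated]) (use xc c in simp)
  obtain u d where u: "u \<in> carrier R" "u \<notin> Q" and d: "d \<in> carrier R"
    and ud: "u \<otimes> (x \<otimes> c) = d \<otimes> j"
    using saturationE[OF subsetD[OF j(3) xcJ]] unfolding PIdl_iff by metis
  have "j \<otimes> (u \<otimes> t) = u \<otimes> (t \<otimes> j)" using jc u t by (simp add: m_ac)
  also have "\<dots> = x \<otimes> (u \<otimes> (x \<otimes> c))" using xc c u by (simp add: tj m_ac)
  also have "\<dots> = j \<otimes> (x \<otimes> d)" using xc jc d by (simp add: ud m_ac)
  finally have "u \<otimes> t = x \<otimes> d"
    by (rule Reg_cancel[OF j(2), rotated 2]) (use u t xc d in simp_all)
  moreover have "x \<otimes> d \<in> Q" using xQ d idQ by (simp add: ideal_closure)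
  ultimately show False using primeideal_mult_notin[OF Q u t] by simp
qed

text \<open>If each factor contains \<open>Q\<close> locally, the product contains a power of \<open>Q\<close> locally, and all powers of an
  idempotent ideal are equal to it.\<close>

lemma idempotent_prime_subset_saturation:
  assumes Q: "primeideal Q R" and idem: "Q \<subseteq> ideal_prod R Q Q"
    and "\<And>K. K \<in> set Ks \<Longrightarrow> ideal K R \<and> Q \<subseteq> saturation Q K"
  shows "Q \<subseteq> saturation Q (ideals_prod Ks)"
  using assms(3)
proof (induction Ks)
  case Nil
  show ?case
    using ideal_subset_saturation[OF Q oneideal] ideal.Icarr[OF primeideal.axioms(1)[OF Q]] by auto
next
  case (Cons K Ks)
  have K: "ideal K R" "Q \<subseteq> saturation Q K" and L: "ideal (ideals_prod Ks) R"
    and QL: "Q \<subseteq> saturation Q (ideals_prod Ks)"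
    using Cons by (auto intro: ideals_prod_ideal)
  have "ideal_prod R Q Q \<subseteq> saturation Q (ideal_prod R K (ideals_prod Ks))"
    by (rule ideal_prod_subset[OF saturation_ideal[OF Q ideal_prod_is_ideal[OF K(1) L]]])
      (use K QL in \<open>blast intro: saturation_mult[OF Q K(1) L]\<close>)
  then show ?case using idem by auto
qed

text \<open>As \<open>P\<close> is strictly smaller than \<open>Q\<close>, it does not contain \<open>x\<close>. So from \<open>t p = q x\<close> with \<open>p \<in> P\<close> follows
  \<open>q \<in> P\<close>, i.e. \<open>P \<subseteq> x P\<close> locally at \<open>Q\<close>; this is applied twice.\<close>

lemma prime_below_uniformizer:
  assumes Q: "primeideal Q R" and x: "uniformizer Q x" and P: "primeideal P R"
    and PQ: "P \<subseteq> Q" "P \<noteq> Q"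
  shows "P \<subseteq> saturation Q (PIdl (x \<otimes> x))"
proof -
  have xc: "x \<in> carrier R" and Qx: "Q \<subseteq> saturation Q (PIdl x)"
    using x Reg_closed by (auto simp: uniformizer_def)
  have idP: "ideal P R" using P by (rule primeideal.axioms)
  have "x \<notin> P"
  proof
    assume xP: "x \<in> P"
    have "q \<in> P" if q: "q \<in> Q" for q
    proof -
      obtain t where t: "t \<in> carrier R" "t \<notin> Q" "q \<in> carrier R" "t \<otimes> q \<in> PIdl x"
        using q Qx by (blast elim: saturationE)
      then have "t \<otimes> q \<in> P" using cgenideal_minimal[OF idP xP] by blast
      then show ?thesis using primeideal_mult_notin[OF P t(1) _ t(3)] t(2) PQ(1) by blast
    qed
    then show False using PQ by blast
  qed
  have step: "\<exists>t q. t \<in> carrier R \<and> t \<notin> Q \<and> q \<in> P \<and> t \<otimes> p = q \<otimes> x" if p: "p \<in> P" for p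
  proof -
    have "p \<in> saturation Q (PIdl x)" using p PQ(1) Qx by blast
    then obtain t q where t: "t \<in> carrier R" "t \<notin> Q" "q \<in> carrier R" "t \<otimes> p = q \<otimes> x"
      by (auto elim!: saturationE simp: PIdl_iff)
    have "q \<otimes> x \<in> P" using p t(1) idP by (simp add: ideal_closure flip: t(4))
    then have "q \<in> P" using primeideal_mult_notin[OF P t(3) _ xc] \<open>x \<notin> P\<close> by blast
    then show ?thesis using t by blast
  qed
  show ?thesis
  proof
    fix p assume p: "p \<in> P"
    then obtain t q where t: "t \<in> carrier R" "t \<notin> Q" "q \<in> P" "t \<otimes> p = q \<otimes> x"
      using step by blast
    obtain s r where s: "s \<in> carrier R" "s \<notin> Q" "r \<in> P" "s \<otimes> q = r \<otimes> x"
      using step[OF t(3)] by blast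
    have c: "p \<in> carrier R" "q \<in> carrier R" "r \<in> carrier R"
      using p t(3) s(3) idP by (auto simp: ideal_closure)
    have "(s \<otimes> t) \<otimes> p = (s \<otimes> q) \<otimes> x" using s(1) t(1,4) c xc by (simp add: m_assoc)
    also have "\<dots> = r \<otimes> (x \<otimes> x)" using c xc by (simp add: s(4) m_assoc)
    finally have "(s \<otimes> t) \<otimes> p \<in> PIdl (x \<otimes> x)" using c by (auto simp: PIdl_iff)
    then show "p \<in> saturation Q (PIdl (x \<otimes> x))"
      by (intro saturationI[of "s \<otimes> t"]) (use s t c Q in \<open>simp_all add: primeideal_mult_notin\<close>)
  qed
qed

lemma radical_ideal_Inter:
  assumes "S \<noteq> {}" "\<And>I. I \<in> S \<Longrightarrow> radical_ideal I R"
  shows "radical_ideal (\<Inter>S) R"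
proof -
  have id: "ideal (\<Inter>S) R" using assms radical_ideal_ideal by (intro i_Intersect) auto
  have "radical R (\<Inter>S) \<subseteq> \<Inter>S" using assms(2) radical_idealD unfolding radical_def by blast
  moreover have "\<Inter>S \<subseteq> radical R (\<Inter>S)"
  proof
    fix x assume x: "x \<in> \<Inter>S"
    then have "x \<in> carrier R" using id by (blast intro: ideal.Icarr)
    moreover from this have "x [^] (1::nat) \<in> \<Inter>S" using x by simp
    ultimately show "x \<in> radical R (\<Inter>S)" unfolding radical_def using zero_less_one by blast
  qed
  ultimately show ?thesis using id unfolding radical_ideal_def by blast
qed

text \<open>The prime \<open>Q\<close> is taken minimal not over \<open>P + (z)\<close> itself but over the intersection \<open>I\<close> of its
  radical factors. This is a radical ideal, and a power of each of its elements lies in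
  \<open>P + (z)\<close>; so every radical ideal that contains \<open>P\<close> and \<open>z\<^sup>2\<close> contains \<open>I\<close>.\<close>

lemma exists_uniformizer:
  assumes marot: "marot_ring R" and SP: "SP_ring R"
    and M: "primeideal M R" "regular_ideal M R"
  shows "\<exists>x. uniformizer M x"
proof (rule ccontr)
  assume no: "\<nexists>x. uniformizer M x"
  obtain r where r: "r \<in> Reg R" "r \<in> M" using M(2) unfolding regular_ideal_def by blast
  obtain J where J: "radical_ideal J R" "invertible_ideal J" "r \<in> J" "J \<subseteq> M"
    using SP_ring_radical_invertible_factor[OF SP M(1) r] by blast
  obtain P where P: "primeideal P R" "J \<subseteq> P" "P \<subseteq> M" "P \<subseteq> saturation P J"
    using exists_minimal_prime[OF M(1) J(1,4)] by blast
  have idP: "ideal P R" using P(1) by (rule primeideal.axioms)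
  \<comment> \<open>otherwise \<open>M\<close> would be locally equal to \<open>J\<close>, hence locally principal\<close>
  have "P \<noteq> M"
  proof
    assume "P = M"
    obtain j where j: "j \<in> J" "j \<in> Reg R" "J \<subseteq> saturation M (PIdl j)"
      using invertible_ideal_locally_principal[OF marot M(1) J(2)] by blast
    have "M \<subseteq> saturation M (PIdl j)"
    proof
      fix m assume "m \<in> M"
      then obtain t where t: "t \<in> carrier R" "t \<notin> M" "m \<in> carrier R" "t \<otimes> m \<in> J"
        using P(4) \<open>P = M\<close> by (blast elim: saturationE)
      then show "m \<in> saturation M (PIdl j)" using saturation_cancel[OF M(1) t(1-3)] j(3) by blast
    qed
    then show False using no j J(4) unfolding uniformizer_def by blast
  qed
  then obtain z where z: "z \<in> M" "z \<notin> P" using P(3) by blast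
  have zc: "z \<in> carrier R" using z(1) primeideal.axioms(1)[OF M(1)] by (simp add: ideal_closure)
  have "r \<in> P" using J(3) P(2) by blast
  have reg: "regular_ideal (adjoin P a) R" if "a \<in> carrier R" for a
    using adjoin_ideal[OF idP that] subset_adjoin[OF idP that] \<open>r \<in> P\<close> r(1)
    unfolding regular_ideal_def by blast
  obtain Ks where Ks: "\<And>K. K \<in> set Ks \<Longrightarrow> radical_ideal K R" "adjoin P z = ideals_prod Ks"
    using SP_ring_factorization[OF SP reg[OF zc]] by blast
  have idK: "\<And>K. K \<in> set Ks \<Longrightarrow> ideal K R" using Ks(1) radical_ideal_ideal by blast
  have "adjoin P z \<subseteq> M" using adjoin_subset[OF primeideal.axioms(1)[OF M(1)] P(3) z(1)] .
  then obtain K0 where K0: "K0 \<in> set Ks" "K0 \<subseteq> M"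
    using ideals_prod_subset_prime[OF M(1) _ idK, of Ks] Ks(2) by auto
  define I where "I = \<Inter>(set Ks)"
  have "radical_ideal I R"
    unfolding I_def by (rule radical_ideal_Inter) (use K0 Ks(1) in auto)
  moreover have "I \<subseteq> M" unfolding I_def using K0 by blast
  ultimately have I: "radical_ideal I R" "I \<subseteq> M" by blast+
  have subI: "adjoin P z \<subseteq> I" using ideals_prod_subset[OF idK] Ks(2) unfolding I_def by auto
  obtain Q where Q: "primeideal Q R" "I \<subseteq> Q" "Q \<subseteq> M" "Q \<subseteq> saturation Q I"
    using exists_minimal_prime[OF M(1) I] by blast
  have PQ: "P \<subseteq> Q" and zQ: "z \<in> Q"
    using subset_adjoin[OF idP zc] self_in_adjoin[OF idP zc] subI Q(2) by auto
  show False
  proof (cases "\<exists>y. uniformizer Q y")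
    case True
    then obtain y where y: "uniformizer Q y" by blast
    have "P \<noteq> Q" using zQ z(2) by blast
    then have "J \<subseteq> saturation Q (PIdl (y \<otimes> y))"
      using prime_below_uniformizer[OF Q(1) y P(1) PQ] P(2) by blast
    then show False using radical_invertible_not_in_square[OF marot Q(1) y J(1,2)] by blast
  next
    case False
    have "regular_ideal Q R"
      using \<open>r \<in> P\<close> r(1) PQ primeideal.axioms(1)[OF Q(1)] unfolding regular_ideal_def by blast
    then have idem: "Q \<subseteq> ideal_prod R Q Q"
      using prime_idempotent_or_uniformizer[OF marot SP Q(1)] False by blast
    obtain Ls where Ls: "\<And>L. L \<in> set Ls \<Longrightarrow> radical_ideal L R"
      "adjoin P (z \<otimes> z) = ideals_prod Ls"
      using SP_ring_factorization[OF SP reg[of "z \<otimes> z"]] zc by auto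
    have idL: "\<And>L. L \<in> set Ls \<Longrightarrow> ideal L R" using Ls(1) radical_ideal_ideal by blast
    have IL: "I \<subseteq> L" if L: "L \<in> set Ls" for L
    proof
      have "adjoin P (z \<otimes> z) \<subseteq> L" using ideals_prod_subset[OF idL L] Ls(2) by simp
      then have "P \<subseteq> L" "z \<otimes> z \<in> L"
        using subset_adjoin[OF idP, of "z \<otimes> z"] self_in_adjoin[OF idP, of "z \<otimes> z"] zc by auto
      then have PzL: "adjoin P z \<subseteq> L"
        using radical_ideal_square[OF Ls(1)[OF L] zc] adjoin_subset[OF idL[OF L]] by blast
      fix y assume y: "y \<in> I"
      have yc: "y \<in> carrier R" using y radical_ideal_ideal[OF I(1)] by (simp add: ideal_closure)
      have "y [^] length Ks \<in> L"
        using pow_mem_ideals_prod[of y Ks] y yc Ks(2) PzL unfolding I_def by auto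
      then have "y [^] Suc (length Ks) \<in> L" using idL[OF L] yc by (simp add: ideal_closure)
      then show "y \<in> L" by (rule radical_idealD[OF Ls(1)[OF L] yc]) simp
    qed
    have "Q \<subseteq> saturation Q (ideals_prod Ls)"
      by (rule idempotent_prime_subset_saturation[OF Q(1) idem])
        (use idL Q(4) saturation_mono[OF IL] in blast)
    then have "z \<in> saturation Q P"
      using saturation_add_square[OF Q(1) idP zQ] zQ Ls(2) by auto
    then obtain t where "t \<in> carrier R" "t \<notin> Q" "t \<otimes> z \<in> P" by (elim saturationE)
    then show False using primeideal_mult_notin[OF P(1) _ _ zc z(2)] PQ by blast
  qed
qed

section \<open>The order of a regular element\<close>

text \<open>A coefficient \<open>c \<in> M\<close> would be a multiple of \<open>x\<close> locally and raise the order of \<open>a\<close>.\<close>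

lemma uniformizer_leading_coefficient:
  assumes M: "primeideal M R" and x: "uniformizer M x"
    and t: "t \<in> carrier R" "t \<notin> M" and a: "a \<in> carrier R" and c: "c \<in> carrier R"
    and eq: "t \<otimes> a = c \<otimes> x [^] (n::nat)" and not: "a \<notin> saturation M (PIdl (x [^] Suc n))"
  shows "c \<notin> M"
proof
  assume "c \<in> M"
  have xc: "x \<in> carrier R" using x Reg_closed by (auto simp: uniformizer_def)
  have "c \<in> saturation M (PIdl x)" using x \<open>c \<in> M\<close> by (auto simp: uniformizer_def)
  then obtain s d where s: "s \<in> carrier R" "s \<notin> M" "d \<in> carrier R" "s \<otimes> c = d \<otimes> x"
    by (auto elim!: saturationE simp: PIdl_iff)
  have "(s \<otimes> t) \<otimes> a = (s \<otimes> c) \<otimes> x [^] n" using s(1) t(1) a c xc eq by (simp add: m_assoc)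
  also have "\<dots> = d \<otimes> x [^] Suc n" using s(3) xc by (simp add: s(4) m_ac)
  finally have "(s \<otimes> t) \<otimes> a \<in> PIdl (x [^] Suc n)" using s(3) unfolding PIdl_iff by blast
  then have "a \<in> saturation M (PIdl (x [^] Suc n))"
    by (intro saturationI[of "s \<otimes> t"]) (use s t a M in \<open>simp_all add: primeideal_mult_notin\<close>)
  then show False using not by blast
qed

lemma exact_order:
  assumes M: "primeideal M R" and a: "a \<in> carrier R"
    and not: "a \<notin> saturation M (PIdl (x [^] Suc n))"
  obtains e where "e \<le> n" "a \<in> saturation M (PIdl (x [^] e))"
    "a \<notin> saturation M (PIdl (x [^] Suc e))"
proof -
  define e where "e = (LEAST e. a \<notin> saturation M (PIdl (x [^] Suc e)))"
  have e: "a \<notin> saturation M (PIdl (x [^] Suc e))" "e \<le> n"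
    unfolding e_def using not by (rule LeastI, rule Least_le)
  have "a \<in> saturation M (PIdl (x [^] e))"
  proof (cases e)
    case 0
    have "a \<in> PIdl (x [^] e)" using a 0 by (auto simp: PIdl_iff)
    then show ?thesis
      using ideal_subset_saturation[OF M cgenideal_ideal[of "x [^] e"]] 0 by auto
  next
    case (Suc k)
    then show ?thesis
      using not_less_Least[of k "\<lambda>e. a \<notin> saturation M (PIdl (x [^] Suc e))"] e_def by simp
  qed
  then show ?thesis using e that by blast
qed

text \<open>The order of \<open>a\<close> with respect to \<open>x\<close> is the largest \<open>e\<close> such that \<open>a\<close> lies in \<open>(x\<^sup>e)\<close> locally at \<open>M\<close>.
  Leading coefficients lie outside the prime \<open>M\<close>, and so does their product; hence orders add up and
  upper bounds for them do as well.\<close>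

lemma order_mult:
  assumes M: "primeideal M R" and x: "uniformizer M x" and ab: "a \<in> carrier R" "b \<in> carrier R"
    and a: "a \<notin> saturation M (PIdl (x [^] Suc m))"
    and b: "b \<notin> saturation M (PIdl (x [^] Suc n))"
  shows "a \<otimes> b \<notin> saturation M (PIdl (x [^] Suc (m + n)))"
proof
  assume "a \<otimes> b \<in> saturation M (PIdl (x [^] Suc (m + n)))"
  then obtain t d where t: "t \<in> carrier R" "t \<notin> M" "d \<in> carrier R"
    "t \<otimes> (a \<otimes> b) = d \<otimes> x [^] Suc (m + n)"
    by (auto elim!: saturationE simp only: PIdl_iff)
  have xM: "x \<in> M" and xR: "x \<in> Reg R" using x by (auto simp: uniformizer_def)
  note xc = Reg_closed[OF xR]
  obtain e where e: "e \<le> m" "a \<in> saturation M (PIdl (x [^] e))"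
    "a \<notin> saturation M (PIdl (x [^] Suc e))" using exact_order[OF M ab(1) a] .
  obtain f where f: "f \<le> n" "b \<in> saturation M (PIdl (x [^] f))"
    "b \<notin> saturation M (PIdl (x [^] Suc f))" using exact_order[OF M ab(2) b] .
  obtain r u where r: "r \<in> carrier R" "r \<notin> M" "u \<in> carrier R" "r \<otimes> a = u \<otimes> x [^] e"
    using e(2) by (auto elim!: saturationE simp: PIdl_iff)
  obtain s w where s: "s \<in> carrier R" "s \<notin> M" "w \<in> carrier R" "s \<otimes> b = w \<otimes> x [^] f"
    using f(2) by (auto elim!: saturationE simp: PIdl_iff)
  have "u \<notin> M" "w \<notin> M"
    using uniformizer_leading_coefficient[OF M x] r s ab e(3) f(3) by blast+
  then have notin: "t \<otimes> (u \<otimes> w) \<notin> M" using r s t M by (simp add: primeideal_mult_notin)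
  obtain k where k: "Suc (m + n) = (e + f) + Suc k"
    using less_imp_Suc_add[of "e + f" "Suc (m + n)"] e(1) f(1) by auto
  have "x [^] (e + f) \<otimes> (t \<otimes> (u \<otimes> w)) = t \<otimes> ((u \<otimes> x [^] e) \<otimes> (w \<otimes> x [^] f))"
    using t(1) r(3) s(3) xc by (simp add: m_ac flip: nat_pow_mult)
  also have "\<dots> = r \<otimes> s \<otimes> (t \<otimes> (a \<otimes> b))"
    using t(1) r(1) s(1) ab by (simp add: m_ac flip: r(4) s(4))
  also have "\<dots> = x [^] (e + f) \<otimes> (r \<otimes> s \<otimes> d \<otimes> x [^] k \<otimes> x)"
    unfolding t(4) k using t(3) r(1) s(1) xc by (simp add: m_ac flip: nat_pow_mult)
  finally have "t \<otimes> (u \<otimes> w) = r \<otimes> s \<otimes> d \<otimes> x [^] k \<otimes> x"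
    by (rule Reg_cancel[OF Reg_pow[OF xR], rotated 2]) (use t r s xc in simp_all)
  moreover have "r \<otimes> s \<otimes> d \<otimes> x [^] k \<otimes> x \<in> M"
    using xM r s t xc primeideal.axioms(1)[OF M] by (simp add: ideal_closure)
  ultimately show False using notin by simp
qed

text \<open>The bound is the number of radical factors of \<open>(s)\<close>: each contains an element of order at most
  1, so their product, which is \<open>(s)\<close>, contains an element whose order is at most that number.\<close>

lemma regular_element_finite_order:
  assumes marot: "marot_ring R" and SP: "SP_ring R" and M: "primeideal M R"
    and x: "uniformizer M x" and s: "s \<in> Reg R"
  shows "\<exists>n. s \<notin> saturation M (PIdl (x [^] Suc n))"
proof -
  have xc: "x \<in> carrier R" using x Reg_closed by (auto simp: uniformizer_def)
  obtain Js where Js: "\<And>J. J \<in> set Js \<Longrightarrow> radical_ideal J R \<and> invertible_ideal J"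
    "PIdl s = ideals_prod Js"
    using SP_ring_invertible_factorization[OF SP s] by blast
  have "\<exists>a\<in>ideals_prod Js. a \<notin> saturation M (PIdl (x [^] Suc (length Js)))"
    using Js(1)
  proof (induction Js)
    case Nil
    have "\<one> \<notin> saturation M (PIdl (x [^] Suc 0))"
    proof
      assume "\<one> \<in> saturation M (PIdl (x [^] Suc 0))"
      then obtain t c where t: "t \<in> carrier R" "t \<notin> M" "c \<in> carrier R" "t = c \<otimes> x"
        using xc by (auto elim!: saturationE simp: PIdl_iff)
      moreover have "c \<otimes> x \<in> M"
        using x t(3) primeideal.axioms(1)[OF M] by (simp add: uniformizer_def ideal_closure)
      ultimately show False by simp
    qed
    then show ?case by auto
  next
    case (Cons J Js)
    obtain b where b: "b \<in> ideals_prod Js" "b \<notin> saturation M (PIdl (x [^] Suc (length Js)))"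
      using Cons by auto
    have J: "radical_ideal J R" "invertible_ideal J" using Cons.prems by auto
    then obtain a where a: "a \<in> J" "a \<notin> saturation M (PIdl (x [^] Suc 1))"
      using radical_invertible_not_in_square[OF marot M x J] xc by auto
    have "ideal (ideals_prod Js) R" using Cons.prems by (auto intro: ideals_prod_ideal radical_ideal_ideal)
    then have "a \<in> carrier R" "b \<in> carrier R"
      using a b radical_ideal_ideal[OF J(1)] by (auto simp: ideal_closure)
    then have "a \<otimes> b \<notin> saturation M (PIdl (x [^] Suc (1 + length Js)))"
      using order_mult[OF M x _ _ a(2) b(2)] by blast
    moreover have "a \<otimes> b \<in> ideals_prod (J # Js)" using a b by (auto intro: ideal_prod.prod)
    ultimately show ?case by (intro bexI[of _ "a \<otimes> b"]) simp_all
  qed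
  then obtain a where a: "a \<in> PIdl s" "a \<notin> saturation M (PIdl (x [^] Suc (length Js)))"
    using Js(2) by auto
  have "ideal (saturation M (PIdl (x [^] Suc (length Js)))) R"
    using saturation_ideal[OF M cgenideal_ideal] xc by simp
  then show ?thesis using a cgenideal_minimal by blast
qed

text \<open>Regular elements are units times powers of \<open>x\<close> in the regular localization; the point is that
  both \<open>t\<close> and \<open>c\<close> are regular, so that they are units there.\<close>

lemma regular_element_factorization:
  assumes marot: "marot_ring R" and SP: "SP_ring R" and M: "primeideal M R"
    and x: "uniformizer M x" and s: "s \<in> Reg R"
  obtains n t c where "t \<in> Reg R" "t \<notin> M" "c \<in> Reg R" "c \<notin> M" "t \<otimes> s = c \<otimes> x [^] (n::nat)"
proof -
  have xR: "x \<in> Reg R" using x by (auto simp: uniformizer_def)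
  note xc = Reg_closed[OF xR] and sc = Reg_closed[OF s]
  obtain m where "s \<notin> saturation M (PIdl (x [^] Suc m))"
    using regular_element_finite_order[OF marot SP M x s] by blast
  then obtain n where n: "s \<in> saturation M (PIdl (x [^] n))"
    "s \<notin> saturation M (PIdl (x [^] Suc n))"
    using exact_order[OF M sc] by blast
  obtain t where t: "t \<in> Reg R" "t \<notin> M" "t \<otimes> s \<in> PIdl (x [^] n)"
    using marot_regular_multiplier[OF marot M PIdl_regular[OF Reg_pow[OF xR]] n(1)] .
  note tc = Reg_closed[OF t(1)]
  obtain c where c: "c \<in> carrier R" "t \<otimes> s = c \<otimes> x [^] n" using t(3) by (auto simp: PIdl_iff)
  have "t \<otimes> s \<in> Reg R" using s t by simp
  then have "c \<in> Reg R" using Reg_factor[of c "x [^] n"] c xc by simp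
  moreover have "c \<notin> M" using uniformizer_leading_coefficient[OF M x tc t(2) sc c n(2)] .
  ultimately show ?thesis using t c that by blast
qed

section \<open>Discrete valuations\<close>

text \<open>The sets \<open>p\<^sup>e V\<close> for integers \<open>e\<close> form a decreasing filtration that exhausts the ring, and
  \<open>v x\<close> is the largest \<open>e\<close> with \<open>x \<in> p\<^sup>e V\<close>, or \<open>\<infinity>\<close> if there is no largest one. Primality of
  \<open>p V\<close> makes \<open>v\<close> multiplicative. Elements outside \<open>p V\<close> need not be units of \<open>V\<close>, and \<open>v\<close> may be \<open>\<infinity>\<close> at nonzero
  elements.\<close>

lemma discrete_valuation_of_prime_element:
  assumes V: "subring V R" and p: "p \<in> V" "p \<in> Units R"
    and one: "\<one> \<notin> (\<otimes>) p ` V"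
    and prime: "\<And>a b. \<lbrakk>a \<in> V; b \<in> V; a \<otimes> b \<in> (\<otimes>) p ` V\<rbrakk> \<Longrightarrow> a \<in> (\<otimes>) p ` V \<or> b \<in> (\<otimes>) p ` V"
    and cover: "\<And>x. x \<in> carrier R \<Longrightarrow> \<exists>n::nat. p [^] n \<otimes> x \<in> V"
  shows "\<exists>v :: 'a \<Rightarrow> int extended. v ` carrier R = range Fin \<union> {\<infinity>} \<and> v \<one> = 0 \<and> v \<zero> = \<infinity> \<and>
    (\<forall>x \<in> carrier R. \<forall>y \<in> carrier R. v (x \<otimes> y) = v x + v y \<and> v (x \<oplus> y) \<ge> min (v x) (v y)) \<and>
    V = {x \<in> carrier R. v x \<ge> 0}"
proof -
  note Vc = subringE(1)[OF V]
  have VD [simp]: "\<And>c. c \<in> V \<Longrightarrow> c \<in> carrier R" using Vc by blast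
  note Vs = subringE(2,3,6,7)[OF V]
  interpret G: group "units_of R" by (rule units_group)
  \<comment> \<open>powers with integer exponents exist in the group of units only\<close>
  define q where "q e = p [^]\<^bsub>units_of R\<^esub> e" for e :: int
  have pG: "p \<in> carrier (units_of R)" using p by (simp add: units_of_carrier)
  have qU: "q e \<in> Units R" for e
    using G.int_pow_closed[OF pG] by (simp add: q_def units_of_carrier)
  then have qc [simp]: "q e \<in> carrier R" for e by blast
  have q_add: "q (e + f) = q e \<otimes> q f" for e f
    using G.int_pow_mult[OF pG] by (simp add: q_def units_of_mult)
  have q_nat: "q (int n) = p [^] n" for n
    by (simp add: q_def int_pow_int units_of_pow p)
  have q0 [simp]: "q 0 = \<one>" and q1: "q 1 = p" using q_nat[of 0] q_nat[of 1] p by auto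
  have pc [simp]: "p \<in> carrier R" using p by blast
  have q_natV: "q (int n) \<in> V" for n
    unfolding q_nat by (induction n) (use p Vs in auto)
  define F where "F e = (\<otimes>) (q e) ` V" for e
  have F_iff: "x \<in> F e \<longleftrightarrow> (\<exists>c\<in>V. x = q e \<otimes> c)" for x e by (auto simp: F_def)
  have Fc: "F e \<subseteq> carrier R" for e using Vc by (auto simp: F_iff)
  have F_antimono: "F f \<subseteq> F e" if "e \<le> f" for e f
  proof
    fix x assume "x \<in> F f"
    then obtain c where c: "c \<in> V" "x = q f \<otimes> c" by (auto simp: F_iff)
    have "f = e + int (nat (f - e))" using that by simp
    then have "q f = q e \<otimes> q (int (nat (f - e)))" using q_add by metis
    then have "x = q e \<otimes> (q (int (nat (f - e))) \<otimes> c)" using c Vc by (simp add: m_assoc subset_iff)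
    then show "x \<in> F e" using Vs(3)[OF q_natV c(1)] unfolding F_iff by blast
  qed
  have F_add: "x \<oplus> y \<in> F e" if "x \<in> F e" "y \<in> F e" for x y e
  proof -
    obtain c d where "c \<in> V" "x = q e \<otimes> c" "d \<in> V" "y = q e \<otimes> d"
      using \<open>x \<in> F e\<close> \<open>y \<in> F e\<close> by (auto simp: F_iff)
    then show ?thesis
      unfolding F_iff using Vc Vs(4) by (intro bexI[of _ "c \<oplus> d"]) (auto simp: r_distr subset_iff)
  qed
  have F_mult: "x \<otimes> y \<in> F (e + f)" if "x \<in> F e" "y \<in> F f" for x y e f
  proof -
    obtain c d where "c \<in> V" "x = q e \<otimes> c" "d \<in> V" "y = q f \<otimes> d"
      using \<open>x \<in> F e\<close> \<open>y \<in> F f\<close> by (auto simp: F_iff)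
    then show ?thesis
      unfolding F_iff using Vc Vs(3)
      by (intro bexI[of _ "c \<otimes> d"]) (auto simp: q_add m_ac subset_iff)
  qed
  have F_Suc: "q e \<otimes> c \<in> F (e + 1) \<longleftrightarrow> c \<in> (\<otimes>) p ` V" if c: "c \<in> V" for c e
  proof -
    have "q e \<otimes> c \<in> F (e + 1) \<longleftrightarrow> (\<exists>d\<in>V. q e \<otimes> c = q e \<otimes> (p \<otimes> d))"
      using Vc unfolding F_iff by (intro bex_cong) (auto simp: q_add q1 m_assoc)
    also have "\<dots> \<longleftrightarrow> (\<exists>d\<in>V. c = p \<otimes> d)"
      using Vc c qU[of e] by (intro bex_cong) (auto simp: Units_l_cancel)
    finally show ?thesis by (auto simp: image_iff)
  qed
  have F_strict: "x \<otimes> y \<notin> F (e + f + 1)"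
    if xy: "x \<in> F e" "x \<notin> F (e + 1)" "y \<in> F f" "y \<notin> F (f + 1)" for x y e f
  proof
    assume prod: "x \<otimes> y \<in> F (e + f + 1)"
    obtain c d where c: "c \<in> V" "x = q e \<otimes> c" and d: "d \<in> V" "y = q f \<otimes> d"
      using xy(1,3) by (auto simp: F_iff)
    have "x \<otimes> y = q (e + f) \<otimes> (c \<otimes> d)"
      using c d Vc by (auto simp: q_add m_ac subset_iff)
    then have "c \<otimes> d \<in> (\<otimes>) p ` V" using prod F_Suc[OF Vs(3)[OF c(1) d(1)]] by simp
    then show False using prime[OF c(1) d(1)] xy(2,4) F_Suc c d by simp
  qed
  have F_cover: "\<exists>e. x \<in> F e" if x: "x \<in> carrier R" for x
  proof -
    obtain n :: nat where n: "p [^] n \<otimes> x \<in> V" using cover[OF x] by blast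
    have "q (- int n) \<otimes> q (int n) = \<one>" unfolding q_add[symmetric] by simp
    then have "x = q (- int n) \<otimes> (p [^] n \<otimes> x)" using x by (simp add: q_nat flip: m_assoc)
    then show ?thesis using n unfolding F_iff by blast
  qed
  define v where
    "v x = (if \<exists>e. x \<in> F e \<and> x \<notin> F (e + 1) then Fin (SOME e. x \<in> F e \<and> x \<notin> F (e + 1)) else \<infinity>)" for x
  have v_fin: "v x = Fin e" if x: "x \<in> F e" "x \<notin> F (e + 1)" for x e
  proof -
    have uniq: "f = e" if f: "x \<in> F f" "x \<notin> F (f + 1)" for f
    proof (rule ccontr)
      assume "f \<noteq> e"
      then have "f + 1 \<le> e \<or> e + 1 \<le> f" by linarith
      then show False using F_antimono[of "f + 1" e] F_antimono[of "e + 1" f] x f by auto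
    qed
    have "(SOME e. x \<in> F e \<and> x \<notin> F (e + 1)) = e"
      by (rule some_equality) (use x uniq in blast)+
    moreover have "\<exists>e. x \<in> F e \<and> x \<notin> F (e + 1)" using x by blast
    ultimately show ?thesis unfolding v_def by simp
  qed
  have v_cases: "(\<exists>e. x \<in> F e \<and> x \<notin> F (e + 1) \<and> v x = Fin e) \<or> ((\<forall>e. x \<in> F e) \<and> v x = \<infinity>)"
    if x: "x \<in> carrier R" for x
  proof (cases "\<exists>e. x \<in> F e \<and> x \<notin> F (e + 1)")
    case True
    then show ?thesis using v_fin by blast
  next
    case False
    obtain e0 where e0: "x \<in> F e0" using F_cover[OF x] by blast
    have up: "x \<in> F e" if "e0 \<le> e" for e
      using that by (induction e rule: int_ge_induct) (use False e0 in auto)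
    have "x \<in> F e" for e using up[of "max e e0"] F_antimono[of e "max e e0"] by auto
    moreover have "v x = \<infinity>" using False unfolding v_def by simp
    ultimately show ?thesis by blast
  qed
  have v_ge: "Fin e \<le> v x \<longleftrightarrow> x \<in> F e" if x: "x \<in> carrier R" for x e
    using v_cases[OF x]
  proof
    assume "\<exists>f. x \<in> F f \<and> x \<notin> F (f + 1) \<and> v x = Fin f"
    then obtain f where f: "x \<in> F f" "x \<notin> F (f + 1)" "v x = Fin f" by blast
    show ?thesis using f F_antimono[of e f] F_antimono[of "f + 1" e] by (cases "e \<le> f") auto
  qed simp
  have v_mult: "v (x \<otimes> y) = v x + v y" if xy: "x \<in> carrier R" "y \<in> carrier R" for x y
  proof -
    \<comment> \<open>an element of infinite value can be paired with any other, as the latter lies in some \<open>F f\<close>\<close>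
    have inf: "v (a \<otimes> b) = \<infinity>" if ab: "a \<in> carrier R" "b \<in> carrier R" and a: "\<forall>e. a \<in> F e" for a b
    proof -
      obtain f where "b \<in> F f" using F_cover[OF ab(2)] by blast
      then have "a \<otimes> b \<in> F (e - f + f)" for e using a F_mult by blast
      then show ?thesis using v_cases[of "a \<otimes> b"] ab by auto
    qed
    from v_cases[OF xy(1)] v_cases[OF xy(2)] show ?thesis
    proof (elim disjE exE conjE)
      fix e f assume "x \<in> F e" "x \<notin> F (e + 1)" "y \<in> F f" "y \<notin> F (f + 1)" "v x = Fin e" "v y = Fin f"
      then show ?thesis using v_fin[OF F_mult F_strict] by simp
    next
      fix e assume "v x = Fin e" "v y = \<infinity>" "\<forall>e. y \<in> F e"
      then show ?thesis using inf[OF xy(2,1)] xy by (simp add: m_comm)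
    next
      fix e assume "v y = Fin e" "v x = \<infinity>" "\<forall>e. x \<in> F e"
      then show ?thesis using inf[OF xy] by simp
    next
      assume "v x = \<infinity>" "v y = \<infinity>" "\<forall>e. x \<in> F e"
      then show ?thesis using inf[OF xy] by simp
    qed
  qed
  have v_add: "min (v x) (v y) \<le> v (x \<oplus> y)" if xy: "x \<in> carrier R" "y \<in> carrier R" for x y
  proof -
    have mono: "x \<oplus> y \<in> F e" if "Fin e \<le> min (v x) (v y)" for e
      using that F_add[of x e y] v_ge xy by simp
    show ?thesis
    proof (cases "min (v x) (v y)")
      case (Fin e)
      then show ?thesis using mono[of e] v_ge[of "x \<oplus> y" e] xy by simp
    next
      case Pinf
      then have "x \<oplus> y \<in> F e" for e using mono[of e] by simp
      then show ?thesis using v_cases[of "x \<oplus> y"] xy by auto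
    qed simp
  qed
  have v_q: "v (q e) = Fin e" for e
  proof (rule v_fin)
    show "q e \<in> F e" using Vs(2) unfolding F_iff by (intro bexI[of _ \<one>]) simp_all
    show "q e \<notin> F (e + 1)" using F_Suc[OF Vs(2), of e] one by simp
  qed
  have v_zero: "v \<zero> = \<infinity>"
  proof -
    have "\<zero> \<in> F e" for e using Vs(1) unfolding F_iff by (intro bexI[of _ \<zero>]) simp_all
    then show ?thesis using v_cases[of \<zero>] by auto
  qed
  have "v ` carrier R = range Fin \<union> {\<infinity>}"
  proof
    show "v ` carrier R \<subseteq> range Fin \<union> {\<infinity>}" using v_cases by blast
    show "range Fin \<union> {\<infinity>} \<subseteq> v ` carrier R"
      using imageI[OF qc, of v] imageI[OF zero_closed, of v] unfolding v_q v_zero by blast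
  qed
  moreover have "v \<one> = 0" using v_q[of 0] by (simp add: zero_extended_def)
  moreover have "V = {x \<in> carrier R. v x \<ge> 0}"
  proof -
    have "F 0 = V" by (auto simp: F_iff)
    then show ?thesis using v_ge[of _ 0] Vc by (auto simp: zero_extended_def)
  qed
  ultimately show ?thesis using v_mult v_add v_zero by blast
qed

section \<open>Regular localizations\<close>

lemma fraction_in_localization:
  "\<lbrakk>a \<in> carrier R; t \<in> Reg R; t \<notin> P\<rbrakk> \<Longrightarrow> fraction R a t \<in> regular_localization R P"
  unfolding regular_localization_def using Reg_closed by blast

lemma regular_localizationE:
  assumes "k \<in> regular_localization R P"
  obtains a t where "a \<in> carrier R" "t \<in> Reg R" "t \<notin> P" "k = fraction R a t"
  using assms unfolding regular_localization_def by blast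

lemma fraction_in_total_quot:
  "\<lbrakk>a \<in> carrier R; t \<in> Reg R\<rbrakk> \<Longrightarrow> fraction R a t \<in> carrier (total_quot R)"
  unfolding total_quot_carrier by blast

lemma fraction_zero_iff:
  assumes "a \<in> carrier R" "t \<in> Reg R"
  shows "fraction R a t = \<zero>\<^bsub>total_quot R\<^esub> \<longleftrightarrow> a = \<zero>"
  using assms Reg_closed[OF assms(2)] by (simp add: total_quot_zero fraction_eq_iff)

lemma fraction_inverse:
  assumes "a \<in> Reg R" "t \<in> Reg R"
  shows "fraction R a t \<in> Units (total_quot R)"
    and "inv\<^bsub>total_quot R\<^esub> fraction R a t = fraction R t a"
proof -
  interpret K: cring "total_quot R" by (rule total_quot_cring)
  note c = Reg_closed[OF assms(1)] Reg_closed[OF assms(2)]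
  note mem = fraction_in_total_quot[OF c(1) assms(2)] fraction_in_total_quot[OF c(2) assms(1)]
  have eq: "fraction R a t \<otimes>\<^bsub>total_quot R\<^esub> fraction R t a = \<one>\<^bsub>total_quot R\<^esub>"
    using assms c by (simp add: total_quot_mult total_quot_one fraction_eq_iff m_comm)
  have "fraction R t a \<otimes>\<^bsub>total_quot R\<^esub> fraction R a t = \<one>\<^bsub>total_quot R\<^esub>"
    using K.m_comm[OF mem] eq by simp
  then show "fraction R a t \<in> Units (total_quot R)"
    using mem eq unfolding Units_def by blast
  show "inv\<^bsub>total_quot R\<^esub> fraction R a t = fraction R t a"
    by (rule K.comm_inv_char[OF mem eq])
qed

lemma regular_localization_subring:
  assumes P: "primeideal P R"
  shows "subring (regular_localization R P) (total_quot R)"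
proof -
  interpret K: cring "total_quot R" by (rule total_quot_cring)
  note one = primeideal_one_notin[OF P]
  show ?thesis
  proof (rule K.subringI)
    show "regular_localization R P \<subseteq> carrier (total_quot R)"
      by (auto elim!: regular_localizationE intro: fraction_in_total_quot)
    show "\<one>\<^bsub>total_quot R\<^esub> \<in> regular_localization R P"
      using one by (simp add: total_quot_one fraction_in_localization)
  next
    fix h assume "h \<in> regular_localization R P"
    then obtain a t where a: "a \<in> carrier R" "t \<in> Reg R" "t \<notin> P" "h = fraction R a t"
      by (rule regular_localizationE)
    have "fraction R (\<ominus> a) t \<oplus>\<^bsub>total_quot R\<^esub> h = \<zero>\<^bsub>total_quot R\<^esub>"
      using a by (simp add: total_quot_add_same l_neg fraction_zero_iff)
    then have "\<ominus>\<^bsub>total_quot R\<^esub> h = fraction R (\<ominus> a) t"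
      using a by (intro K.minus_equality) (auto intro: fraction_in_total_quot)
    then show "\<ominus>\<^bsub>total_quot R\<^esub> h \<in> regular_localization R P"
      using a by (simp add: fraction_in_localization)
  next
    fix h k assume "h \<in> regular_localization R P" "k \<in> regular_localization R P"
    then obtain a s b t where a: "a \<in> carrier R" "s \<in> Reg R" "s \<notin> P" "h = fraction R a s"
      and b: "b \<in> carrier R" "t \<in> Reg R" "t \<notin> P" "k = fraction R b t"
      by (auto elim!: regular_localizationE)
    have "s \<otimes> t \<notin> P" using primeideal_mult_notin[OF P] a b Reg_closed by blast
    then show "h \<otimes>\<^bsub>total_quot R\<^esub> k \<in> regular_localization R P"
      "h \<oplus>\<^bsub>total_quot R\<^esub> k \<in> regular_localization R P"
      using a b Reg_closed
      by (auto simp: total_quot_mult total_quot_add intro!: fraction_in_localization)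
  qed
qed

text \<open>A regular element of the localization has a regular numerator, hence is invertible in the total
  quotient ring.\<close>

lemma regular_localization_total_quotient:
  assumes P: "primeideal P R"
  shows "has_total_quotient_ring (regular_localization R P) (total_quot R)"
proof -
  interpret K: cring "total_quot R" by (rule total_quot_cring)
  let ?V = "regular_localization R P"
  let ?RV = "Reg (total_quot R\<lparr>carrier := ?V\<rparr>)"
  note one = primeideal_one_notin[OF P]
  have RegV: "k \<in> ?RV \<longleftrightarrow> k \<in> ?V \<and>
    (\<forall>y\<in>?V. k \<otimes>\<^bsub>total_quot R\<^esub> y = \<zero>\<^bsub>total_quot R\<^esub> \<longrightarrow> y = \<zero>\<^bsub>total_quot R\<^esub>)" for k
    by (simp add: Reg_def)
  have units: "?RV \<subseteq> Units (total_quot R)"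
  proof
    fix k assume k: "k \<in> ?RV"
    then obtain a t where a: "a \<in> carrier R" "t \<in> Reg R" "t \<notin> P" "k = fraction R a t"
      unfolding RegV by (blast elim: regular_localizationE)
    have "b = \<zero>" if b: "b \<in> carrier R" "a \<otimes> b = \<zero>" for b
    proof -
      have "k \<otimes>\<^bsub>total_quot R\<^esub> fraction R b \<one> = \<zero>\<^bsub>total_quot R\<^esub>"
        using a b by (simp add: total_quot_mult fraction_zero_iff)
      then have "fraction R b \<one> = \<zero>\<^bsub>total_quot R\<^esub>"
        using k fraction_in_localization[OF b(1) Reg_one one] unfolding RegV by blast
      then show ?thesis using b by (simp add: fraction_zero_iff)
    qed
    then have "a \<in> Reg R" using a(1) by (auto simp: Reg_def)
    then show "k \<in> Units (total_quot R)" using a fraction_inverse(1) by simp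
  qed
  have "\<exists>b s. k = b \<otimes>\<^bsub>total_quot R\<^esub> inv\<^bsub>total_quot R\<^esub> s \<and> b \<in> ?V \<and> s \<in> ?RV"
    if k: "k \<in> carrier (total_quot R)" for k
  proof -
    obtain a s where a: "a \<in> carrier R" "s \<in> Reg R" "k = fraction R a s"
      using k unfolding total_quot_carrier by blast
    note sc = Reg_closed[OF a(2)]
    have "k = fraction R a \<one> \<otimes>\<^bsub>total_quot R\<^esub> inv\<^bsub>total_quot R\<^esub> fraction R s \<one>"
      using a sc by (simp add: fraction_inverse(2) total_quot_mult)
    moreover have "fraction R s \<one> \<in> ?RV"
      unfolding RegV
    proof (intro conjI ballI impI)
      show "fraction R s \<one> \<in> ?V" using sc one by (simp add: fraction_in_localization)
      fix y assume "y \<in> ?V" and 0: "fraction R s \<one> \<otimes>\<^bsub>total_quot R\<^esub> y = \<zero>\<^bsub>total_quot R\<^esub>"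
      then obtain b t where b: "b \<in> carrier R" "t \<in> Reg R" "y = fraction R b t"
        by (blast elim: regular_localizationE)
      have "s \<otimes> b = \<zero>" using 0 b sc by (simp add: total_quot_mult fraction_zero_iff Reg_closed)
      then show "y = \<zero>\<^bsub>total_quot R\<^esub>" using RegD[OF a(2) b(1)] b by (simp add: fraction_zero_iff)
    qed
    ultimately show ?thesis using fraction_in_localization[OF a(1) Reg_one one] by blast
  qed
  moreover have "b \<otimes>\<^bsub>total_quot R\<^esub> inv\<^bsub>total_quot R\<^esub> s \<in> carrier (total_quot R)"
    if "b \<in> ?V" "s \<in> ?RV" for b s
    using that units subringE(1)[OF regular_localization_subring[OF P]] by blast
  ultimately have "carrier (total_quot R) =
      {b \<otimes>\<^bsub>total_quot R\<^esub> inv\<^bsub>total_quot R\<^esub> s | b s. b \<in> ?V \<and> s \<in> ?RV}"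
    by blast
  then show ?thesis
    unfolding has_total_quotient_ring_def
    using total_quot_cring regular_localization_subring[OF P] units by blast
qed

text \<open>The ideal generated by the uniformizer in the regular localization contracts to \<open>M\<close>, which is
  what makes it prime there.\<close>

lemma regular_localization_uniformizer_multiple:
  assumes marot: "marot_ring R" and M: "primeideal M R" and x: "uniformizer M x"
    and a: "a \<in> carrier R" "t \<in> Reg R" "t \<notin> M"
  shows "fraction R a t \<in> (\<otimes>\<^bsub>total_quot R\<^esub>) (fraction R x \<one>) ` regular_localization R M \<longleftrightarrow> a \<in> M"
proof
  have xM: "x \<in> M" and xR: "x \<in> Reg R" using x by (auto simp: uniformizer_def)
  note xc = Reg_closed[OF xR] and tc = Reg_closed[OF a(2)]
  {
    assume "fraction R a t \<in> (\<otimes>\<^bsub>total_quot R\<^esub>) (fraction R x \<one>) ` regular_localization R M"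
    then obtain b s where b: "b \<in> carrier R" "s \<in> Reg R" "s \<notin> M"
      "fraction R a t = fraction R x \<one> \<otimes>\<^bsub>total_quot R\<^esub> fraction R b s"
      by (blast elim: regular_localizationE)
    note sc = Reg_closed[OF b(2)]
    have "s \<otimes> a = x \<otimes> b \<otimes> t"
      using b a xc sc by (simp add: total_quot_mult fraction_eq_iff m_comm)
    moreover have "x \<otimes> b \<otimes> t \<in> M"
      using xM b(1) tc primeideal.axioms(1)[OF M] by (simp add: ideal_closure)
    ultimately show "a \<in> M" using primeideal_mult_notin[OF M sc b(3) a(1)] by auto
  }
  assume "a \<in> M"
  then have "a \<in> saturation M (PIdl x)" using x by (auto simp: uniformizer_def)
  then obtain s where s: "s \<in> Reg R" "s \<notin> M" "s \<otimes> a \<in> PIdl x"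
    using marot_regular_multiplier[OF marot M PIdl_regular[OF xR]] by blast
  note sc = Reg_closed[OF s(1)]
  obtain c where c: "c \<in> carrier R" "s \<otimes> a = c \<otimes> x" using s(3) by (auto simp: PIdl_iff)
  have "a \<otimes> (s \<otimes> t) = (s \<otimes> a) \<otimes> t" using a tc sc by (simp add: m_ac)
  also have "\<dots> = x \<otimes> c \<otimes> t" using c xc by (simp add: m_comm)
  finally have "fraction R a t = fraction R x \<one> \<otimes>\<^bsub>total_quot R\<^esub> fraction R c (s \<otimes> t)"
    using a s c xc sc tc by (simp add: total_quot_mult fraction_eq_iff)
  moreover have "fraction R c (s \<otimes> t) \<in> regular_localization R M"
    using a s c sc tc primeideal_mult_notin[OF M] by (simp add: fraction_in_localization)
  ultimately show "fraction R a t \<in> (\<otimes>\<^bsub>total_quot R\<^esub>) (fraction R x \<one>) ` regular_localization R M"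
    by blast
qed

lemma fraction_pow:
  assumes "a \<in> carrier R"
  shows "fraction R a \<one> [^]\<^bsub>total_quot R\<^esub> (n::nat) = fraction R (a [^] n) \<one>"
proof -
  interpret K: cring "total_quot R" by (rule total_quot_cring)
  show ?thesis by (induction n) (use assms in \<open>simp_all add: total_quot_one total_quot_mult\<close>)
qed

lemma regular_localization_discrete_valuation_ring:
  assumes marot: "marot_ring R" and SP: "SP_ring R"
    and M: "primeideal M R" "regular_ideal M R"
  shows "discrete_rank_one_Manis_valuation_ring (regular_localization R M) (total_quot R)"
proof -
  interpret K: cring "total_quot R" by (rule total_quot_cring)
  let ?V = "regular_localization R M"
  obtain x where x: "uniformizer M x" using exists_uniformizer[OF marot SP M] by blast
  have xR: "x \<in> Reg R" using x by (simp add: uniformizer_def)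
  note xc = Reg_closed[OF xR] and one = primeideal_one_notin[OF M(1)]
  let ?p = "fraction R x \<one>"
  note mult_iff = regular_localization_uniformizer_multiple[OF marot M(1) x]
  have not_one: "\<one>\<^bsub>total_quot R\<^esub> \<notin> (\<otimes>\<^bsub>total_quot R\<^esub>) ?p ` ?V"
    using mult_iff[of \<one> \<one>] one by (simp add: total_quot_one)
  have prime: "h \<in> (\<otimes>\<^bsub>total_quot R\<^esub>) ?p ` ?V \<or> k \<in> (\<otimes>\<^bsub>total_quot R\<^esub>) ?p ` ?V"
    if h: "h \<in> ?V" and k: "k \<in> ?V" and hk: "h \<otimes>\<^bsub>total_quot R\<^esub> k \<in> (\<otimes>\<^bsub>total_quot R\<^esub>) ?p ` ?V" for h k
  proof -
    obtain a s where a: "a \<in> carrier R" "s \<in> Reg R" "s \<notin> M" "h = fraction R a s"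
      using h by (rule regular_localizationE)
    obtain b t where b: "b \<in> carrier R" "t \<in> Reg R" "t \<notin> M" "k = fraction R b t"
      using k by (rule regular_localizationE)
    have "s \<otimes> t \<notin> M" using primeideal_mult_notin[OF M(1)] a b Reg_closed by blast
    then have "a \<otimes> b \<in> M"
      using hk a b mult_iff[of "a \<otimes> b" "s \<otimes> t"] by (simp add: total_quot_mult)
    then have "a \<in> M \<or> b \<in> M" using primeideal_mult_notin[OF M(1)] a b by blast
    then show ?thesis using mult_iff a b by blast
  qed
  have cover: "\<exists>n::nat. ?p [^]\<^bsub>total_quot R\<^esub> n \<otimes>\<^bsub>total_quot R\<^esub> k \<in> ?V"
    if k: "k \<in> carrier (total_quot R)" for k
  proof -
    obtain a s where a: "a \<in> carrier R" "s \<in> Reg R" "k = fraction R a s"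
      using k unfolding total_quot_carrier by blast
    note sc = Reg_closed[OF a(2)]
    obtain n t c where t: "t \<in> Reg R" "t \<notin> M" "c \<in> Reg R" "c \<notin> M" "t \<otimes> s = c \<otimes> x [^] (n::nat)"
      using regular_element_factorization[OF marot SP M(1) x a(2)] .
    note tc = Reg_closed[OF t(1)] and cc = Reg_closed[OF t(3)]
    have "(x [^] n \<otimes> a) \<otimes> c = (c \<otimes> x [^] n) \<otimes> a" using a(1) xc cc by (simp add: m_ac)
    also have "\<dots> = (t \<otimes> a) \<otimes> s" using a(1) tc sc by (simp add: m_ac flip: t(5))
    finally have "?p [^]\<^bsub>total_quot R\<^esub> n \<otimes>\<^bsub>total_quot R\<^esub> k = fraction R (t \<otimes> a) c"
      using a t xc tc cc sc by (simp add: fraction_pow total_quot_mult fraction_eq_iff)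
    moreover have "fraction R (t \<otimes> a) c \<in> ?V"
      using a(1) tc t(3,4) by (simp add: fraction_in_localization)
    ultimately show ?thesis by (metis (no_types))
  qed
  have pV: "?p \<in> ?V" using xc one by (simp add: fraction_in_localization)
  have pU: "?p \<in> Units (total_quot R)" using xR by (simp add: fraction_inverse)
  show ?thesis
    unfolding discrete_rank_one_Manis_valuation_ring_def
    using regular_localization_total_quotient[OF M(1)]
      K.discrete_valuation_of_prime_element[OF regular_localization_subring[OF M(1)]
        pV pU not_one prime cover]
    by (rule conjI)
qed

end

theorem theorem2p6:
  fixes A :: "('a, 'b) ring_scheme"
  assumes "marot_ring A"
    and "SP_ring A"
  shows "N_ring A"
proof -
  interpret cring A using assms(1) by (simp add: marot_ring_def)
  show ?thesis
    unfolding N_ring_def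
    using regular_localization_discrete_valuation_ring[OF assms] maximalideal_prime cring_axioms
    by blast
qed

end
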